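(* Let $S=\mathbb{C}[x,y,z]$ and consider the two line arrangements of degree 9 in $\mathbb{P}^2$ $$\mathcal{A}: f=xy(x-y-z)(x-y+z)(2x+y-2z)(x+3y-3z)(3x+2y+3z)(x+5y+5z)(7x-4y-z)=0,$$ $$\mathcal{A}': f'=xy(4x-5y-5z)(x-y+z)(16x+13y-20z)(x+3y-3z)(3x+2y+3z)(x+5y+5z)(7x-4y-z)=0,$$ which have isomorphic intersection lattices and satisfy $\mathrm{mdr}(f)=5$, $\mathrm{mdr}(f')=6$. (1) Let $\mathcal{A}_1: f_1=0$ (resp. $\mathcal{A}_1': f_1'=0$) be obtained by adding a generic line $L_1$ to $\mathcal{A}$ (resp. a generic line $L_1'$ to $\mathcal{A}'$). Then $L(\mathcal{A}_1)\cong L(\mathcal{A}_1')$, $\mathrm{mdr}(f_1)=6$ and $\mathrm{mdr}(f_1')=7$. (2) Let $p$ be a double point of $\mathcal{A}_1$ and $p'$ a double point of $\mathcal{A}_1'$ corresponding to each other under the isomorphism $L(\mathcal{A}_1)\cong L(\mathcal{A}_1')$. Let $\mathcal{A}_2: f_2=0$ (resp. $\mathcal{A}_2': f_2'=0$) be obtained by adding to $\mathcal{A}_1$ a generic line $L_2$ through $p$ (resp. to $\mathcal{A}_1'$ a generic line $L_2'$ through $p'$). Then $L(\mathcal{A}_2)\cong L(\mathcal{A}_2')$, $\mathrm{mdr}(f_2)=7$ and $\mathrm{mdr}(f_2')=8$. (3) Let $q$ be a double point of $\mathcal{A}_2$ and $q'$ a double point of $\mathcal{A}_2'$ corresponding to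 each other under the isomorphism $L(\mathcal{A}_2)\cong L(\mathcal{A}_2')$. Let $\mathcal{A}_3: f_3=0$ (resp. $\mathcal{A}_3': f_3'=0$) be obtained by adding to $\mathcal{A}_2$ a generic line $L_3$ through $q$ (resp. to $\mathcal{A}_2'$ a generic line $L_3'$ through $q'$). Then $L(\mathcal{A}_3)\cong L(\mathcal{A}_3')$, $\mathrm{mdr}(f_3)=8$ and $\mathrm{mdr}(f_3')=9$; moreover both $\mathcal{A}_3$ and $\mathcal{A}_3'$ have exactly 8 triple points and 42 double points (nodes).
   Context: For a reduced homogeneous polynomial $f\in S=\mathbb{C}[x,y,z]$ with partial derivatives $f_x,f_y,f_z$, let $D_0(f)=\{(a,b,c)\in S^3: af_x+bf_y+cf_z=0\}$, a graded $S$-module (an element has degree $k$ if $a,b,c$ are homogeneous of degree $k$). Then $\mathrm{mdr}(f)$ is the minimal degree of a nonzero homogeneous element of $D_0(f)$. $L(\mathcal{A})$ denotes the intersection lattice of a line arrangement $\mathcal{A}$ in $\mathbb{P}^2$ (the lines and their intersection points, with incidence). A double (resp. triple) point is a point lying on exactly two (resp. three) lines of the arrangement. A generic line means a line outside a suitable proper Zariski closed subset of the dual projective plane; a generic line through a point $p$ means a line outside a suitable finite subset of the pencil of lines through $p$. In particular, a generic line passes through no multiple point of the given arrangement (other than the prescribed point $p$, if any) and is not one of its lines. The isomorphisms $L(\mathcal{A}_1)\cong L(\mathcal{A}_1')$ and $L(\mathcal{A}_2)\cong L(\mathcal{A}_2')$ are the ones extending the isomorphism $L(\mathcal{A})\cong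 L(\mathcal{A}')$ that matches the lines in the order the linear factors are listed, with each added line corresponding to the other added line. *)

theory Defs
  imports "HOL-Analysis.Analysis" "HOL-Computational_Algebra.Polynomial"
begin

section \<open>The polynomial ring \<open>S = \<complex>[x,y,z]\<close>\<close>

text \<open>
  \<open>S\<close> is realised as \<open>\<complex>[x][y][z]\<close>: the outermost polynomial variable is \<open>z\<close>, the innermost is
  \<open>x\<close>, so the coefficient of \<open>x\<^sup>i y\<^sup>j z\<^sup>k\<close> in \<open>P\<close> is \<open>coeff (coeff (coeff P k) j) i\<close>.
\<close>

type_synonym S = "complex poly poly poly"

definition const :: "complex \<Rightarrow> S" where
  "const c = [:[:[:c:]:]:]"

definition var_x :: S where "var_x = [:[:[:0, 1:]:]:]"
definition var_y :: S where "var_y = [:[:0, 1:]:]"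
definition var_z :: S where "var_z = [:0, 1:]"

definition evalS :: "S \<Rightarrow> complex ^ 3 \<Rightarrow> complex" where
  "evalS P v = poly (poly (poly P [:[:v $ 3:]:]) [:v $ 2:]) (v $ 1)"

definition partial_x :: "S \<Rightarrow> S" where "partial_x P = map_poly (map_poly pderiv) P"
definition partial_y :: "S \<Rightarrow> S" where "partial_y P = map_poly pderiv P"
definition partial_z :: "S \<Rightarrow> S" where "partial_z P = pderiv P"

text \<open>As usual, \<open>0\<close> is homogeneous of every degree.\<close>

definition homogeneous :: "nat \<Rightarrow> S \<Rightarrow> bool" where
  "homogeneous d P \<longleftrightarrow> (\<forall>i j k. coeff (coeff (coeff P k) j) i \<noteq> 0 \<longrightarrow> i + j + k = d)"

definition D0 :: "S \<Rightarrow> (S \<times> S \<times> S) set" where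
  "D0 f = {(a, b, c). a * partial_x f + b * partial_y f + c * partial_z f = 0}"

text \<open>The set of degrees is never empty, because of the Koszul syzygies such as \<open>(f\<^sub>y, - f\<^sub>x, 0)\<close>.\<close>

definition mdr :: "S \<Rightarrow> nat" where
  "mdr f = (LEAST k. \<exists>a b c. (a, b, c) \<in> D0 f \<and> (a, b, c) \<noteq> (0, 0, 0) \<and>
                homogeneous k a \<and> homogeneous k b \<and> homogeneous k c)"


section \<open>Points and lines of the projective plane\<close>

text \<open>
  A point of \<open>\<P>\<^sup>2\<close> is a one-dimensional subspace of \<open>\<complex>\<^sup>3\<close>. A line is the set of points on which a
  nonzero linear form vanishes; proportional forms give the same line.
\<close>

type_synonym ppoint = "(complex ^ 3) set"
type_synonym pline = "ppoint set"

definition proj_plane :: "ppoint set" where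
  "proj_plane = {vec.span {v} | v. v \<noteq> 0}"

definition linear_form :: "complex ^ 3 \<Rightarrow> S" where
  "linear_form a = const (a $ 1) * var_x + const (a $ 2) * var_y + const (a $ 3) * var_z"

definition linear_forms :: "S set" where
  "linear_forms = {linear_form a | a. a \<noteq> 0}"

definition line :: "S \<Rightarrow> pline" where
  "line l = {p \<in> proj_plane. \<forall>v\<in>p. evalS l v = 0}"

definition dual_plane :: "pline set" where
  "dual_plane = line ` linear_forms"

text \<open>
  Zariski closed subsets of the dual projective plane: common zero loci of homogeneous
  polynomials in the coefficients \<open>a\<close> of the line \<open>a\<^sub>1 x + a\<^sub>2 y + a\<^sub>3 z = 0\<close>.
\<close>

definition zariski_closed_dual :: "pline set \<Rightarrow> bool" where
  "zariski_closed_dual Z \<longleftrightarrow>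
     (\<exists>E. (\<forall>P\<in>E. \<exists>d. homogeneous d P) \<and>
          Z = {line (linear_form a) | a. a \<noteq> 0 \<and> (\<forall>P\<in>E. evalS P a = 0)})"

definition pencil :: "ppoint \<Rightarrow> pline set" where
  "pencil p = {L \<in> dual_plane. p \<in> L}"


section \<open>Line arrangements and their intersection lattices\<close>

text \<open>
  An arrangement is given by the list of the linear factors of its equation; the order of the
  list records how the lines of two arrangements are matched.
\<close>

type_synonym arrangement = "S list"

definition equation :: "arrangement \<Rightarrow> S" where
  "equation A = prod_list A"

definition lines :: "arrangement \<Rightarrow> pline set" where
  "lines A = line ` set A"

definition multiplicity_at :: "arrangement \<Rightarrow> ppoint \<Rightarrow> nat" where
  "multiplicity_at A p = card {L \<in> lines A. p \<in> L}"

definition multiple_points :: "arrangement \<Rightarrow> ppoint set" where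
  "multiple_points A = {p \<in> proj_plane. multiplicity_at A p \<ge> 2}"

definition double_points :: "arrangement \<Rightarrow> ppoint set" where
  "double_points A = {p \<in> proj_plane. multiplicity_at A p = 2}"

definition triple_points :: "arrangement \<Rightarrow> ppoint set" where
  "triple_points A = {p \<in> proj_plane. multiplicity_at A p = 3}"

text \<open>
  An isomorphism of intersection lattices is a bijection \<open>\<phi>\<close> between the lines together with a
  bijection \<open>\<psi>\<close> between the intersection points which respects incidence in both directions.
\<close>

definition lattice_iso ::
  "arrangement \<Rightarrow> arrangement \<Rightarrow> (pline \<Rightarrow> pline) \<Rightarrow> (ppoint \<Rightarrow> ppoint) \<Rightarrow> bool" where
  "lattice_iso A B \<phi> \<psi> \<longleftrightarrow>
     bij_betw \<phi> (lines A) (lines B) \<and>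
     bij_betw \<psi> (multiple_points A) (multiple_points B) \<and>
     (\<forall>L\<in>lines A. \<forall>p\<in>multiple_points A. p \<in> L \<longleftrightarrow> \<psi> p \<in> \<phi> L)"

definition ordered_lattice_iso ::
  "arrangement \<Rightarrow> arrangement \<Rightarrow> (pline \<Rightarrow> pline) \<Rightarrow> (ppoint \<Rightarrow> ppoint) \<Rightarrow> bool" where
  "ordered_lattice_iso A B \<phi> \<psi> \<longleftrightarrow>
     lattice_iso A B \<phi> \<psi> \<and> map \<phi> (map line A) = map line B"

definition lattices_isomorphic :: "arrangement \<Rightarrow> arrangement \<Rightarrow> bool" where
  "lattices_isomorphic A B \<longleftrightarrow> (\<exists>\<phi> \<psi>. ordered_lattice_iso A B \<phi> \<psi>)"

text \<open>
  A multiple point is determined by the lines through it, so an order-matching isomorphism has a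
  unique effect on the intersection points, and the following relation is the graph of that map.
\<close>

definition corresponding_points ::
  "arrangement \<Rightarrow> arrangement \<Rightarrow> ppoint \<Rightarrow> ppoint \<Rightarrow> bool" where
  "corresponding_points A B p q \<longleftrightarrow>
     (\<exists>\<phi> \<psi>. ordered_lattice_iso A B \<phi> \<psi> \<and> p \<in> multiple_points A \<and> q = \<psi> p)"


section \<open>Generic lines\<close>

text \<open>
  \<open>G\<close> is an admissible choice of the set of generic lines. A property holds for a generic line
  if it holds for all lines of some such \<open>G\<close>.
\<close>

definition generic_lines :: "arrangement \<Rightarrow> pline set \<Rightarrow> bool" where
  "generic_lines A G \<longleftrightarrow>
     (\<exists>Z. zariski_closed_dual Z \<and> Z \<subset> dual_plane \<and> G = dual_plane - Z) \<and>
     (\<forall>L\<in>G. L \<notin> lines A \<and> (\<forall>q\<in>multiple_points A. q \<notin> L))"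

definition generic_lines_through :: "arrangement \<Rightarrow> ppoint \<Rightarrow> pline set \<Rightarrow> bool" where
  "generic_lines_through A p G \<longleftrightarrow>
     (\<exists>F. finite F \<and> F \<subseteq> pencil p \<and> G = pencil p - F) \<and>
     (\<forall>L\<in>G. L \<notin> lines A \<and> (\<forall>q\<in>multiple_points A. q \<noteq> p \<longrightarrow> q \<notin> L))"


section \<open>The two arrangements of nine lines\<close>

definition arrA :: arrangement where
  "arrA =
     [var_x,
      var_y,
      var_x - var_y - var_z,
      var_x - var_y + var_z,
      2 * var_x + var_y - 2 * var_z,
      var_x + 3 * var_y - 3 * var_z,
      3 * var_x + 2 * var_y + 3 * var_z,
      var_x + 5 * var_y + 5 * var_z,
      7 * var_x - 4 * var_y - var_z]"

definition arrA' :: arrangement where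
  "arrA' =
     [var_x,
      var_y,
      4 * var_x - 5 * var_y - 5 * var_z,
      var_x - var_y + var_z,
      16 * var_x + 13 * var_y - 20 * var_z,
      var_x + 3 * var_y - 3 * var_z,
      3 * var_x + 2 * var_y + 3 * var_z,
      var_x + 5 * var_y + 5 * var_z,
      7 * var_x - 4 * var_y - var_z]"

end

theory Submission
  imports Defs
begin

text \<open>
  Up to multiples of the Euler field, the elements of \<open>D\<^sub>0(f)\<close> are the polynomial vector fields
  \<open>\<theta>\<close> tangent to all lines of the arrangement. Let \<open>r = mdr(f)\<close> and add a line \<open>L\<close>. Multiplying by the
  equation of \<open>L\<close> shows that the new \<open>mdr\<close> is at most \<open>r + 1\<close>. If a field \<open>\<theta>\<close> of degree \<open>r\<close> were
  tangent to \<open>L\<close> too, its restriction to \<open>L\<close>, taken modulo the Euler field, would be a form of degree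
  \<open>r + 1\<close> vanishing at the points where \<open>L\<close> meets the other lines. If there are at least \<open>r + 2\<close> such
  points, \<open>\<theta>\<close> is radial along \<open>L\<close>, and subtracting a multiple of the Euler field and dividing by the
  equation of \<open>L\<close> gives a tangent field of degree \<open>r - 1\<close>, a contradiction. This gives all three steps
  of the theorem, and by adding the lines one by one also \<open>mdr \<ge> 5\<close> for both arrangements of nine lines.

  The first of these has an explicit field of degree \<open>5\<close>. For a field \<open>\<theta>\<close> of degree \<open>5\<close> tangent to the
  second one, the form of degree \<open>6\<close> on a line is determined by its zeros up to a constant. At a
  triple point the linear part of \<open>\<theta>\<close> has three eigendirections besides the radial one, hence is a
  scalar, which links the constants of the three lines. Going around a cycle of four lines and four
  triple points multiplies the constants by a number different from \<open>1\<close>, so they vanish, and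
  dividing by the equation of a line again gives a contradiction.
\<close>

section \<open>The polynomial ring\<close>

text \<open>Every line of either nine-line arrangement carries exactly two triple and four double
  points, so six points in all. Excluding degree 5 by adding a ninth line to eight others would take
  seven. Counting therefore stops at the bound 5 for both arrangements: on each line a form of
  degree 6 with six prescribed zeros survives up to a constant. The lattice cannot separate the two
  cases; only the positions of the lines do, through the factor of the cycle.

  The later steps depend on counting alone, and the tighter count is that of the second arrangement,
  whose degree is larger by one. The generic line has one point to spare. A line through a double
  point loses one of its intersections, and with ten and eleven lines the requirement is then met
  with equality.

  Fields are treated modulo the Euler field instead of as syzygies, because tangency can be tested
  one line at a time and is inherited by subarrangements. On the lattice side the order of the list
  fixes the matching of the lines, so an isomorphism becomes an equality of families of index
  sets.\<close>

lemma map_poly_mult_derivation: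
  fixes D :: "'a::comm_ring_1 \<Rightarrow> 'a"
  assumes add: "\<And>x y. D (x + y) = D x + D y"
    and mult: "\<And>x y. D (x * y) = x * D y + D x * y"
  shows "map_poly D (p * q) = p * map_poly D q + map_poly D p * q"
proof (rule poly_eqI)
  have D0: "D 0 = 0"
    using add[of 0 0] by simp
  have D_sum: "D (\<Sum>i\<in>I. g i) = (\<Sum>i\<in>I. D (g i))" if "finite I" for g and I :: "nat set"
    using that by (induction I rule: finite_induct) (simp_all add: D0 add)
  show "coeff (map_poly D (p * q)) n = coeff (p * map_poly D q + map_poly D p * q) n" for n
    by (simp add: coeff_map_poly D0 coeff_mult D_sum mult sum.distrib)
qed

lemma map_poly_add_additive:
  fixes D :: "'a::comm_ring_1 \<Rightarrow> 'a"
  assumes add: "\<And>x y. D (x + y) = D x + D y"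
  shows "map_poly D (p + q) = map_poly D p + map_poly D q"
proof (rule poly_eqI)
  have D0: "D 0 = 0"
    using add[of 0 0] by simp
  show "coeff (map_poly D (p + q)) n = coeff (map_poly D p + map_poly D q) n" for n
    by (simp add: coeff_map_poly D0 add)
qed

lemma partial_z_add: "partial_z (P + Q) = partial_z P + partial_z Q"
  by (simp add: partial_z_def pderiv_add)

lemma partial_z_mult: "partial_z (P * Q) = P * partial_z Q + partial_z P * Q"
  by (simp add: partial_z_def pderiv_mult algebra_simps)

lemma partial_y_add: "partial_y (P + Q) = partial_y P + partial_y Q"
  unfolding partial_y_def by (rule map_poly_add_additive) (rule pderiv_add)

lemma partial_y_mult: "partial_y (P * Q) = P * partial_y Q + partial_y P * Q"
  unfolding partial_y_def
  by (rule map_poly_mult_derivation) (simp_all add: pderiv_add pderiv_mult algebra_simps)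

lemma partial_x_add: "partial_x (P + Q) = partial_x P + partial_x Q"
  unfolding partial_x_def
  by (intro map_poly_add_additive) (rule pderiv_add)

text \<open>\<open>partial_x\<close> acts two coefficient levels down, so the coefficientwise
  lifting of a derivation is used twice.\<close>

lemma partial_x_mult: "partial_x (P * Q) = P * partial_x Q + partial_x P * Q"
  unfolding partial_x_def
  by (intro map_poly_mult_derivation map_poly_add_additive)
     (simp_all add: pderiv_add pderiv_mult algebra_simps)

lemma const_simps:
  "const 0 = 0" "const 1 = 1" "const (a + b) = const a + const b"
  "const (a * b) = const a * const b" "const (- a) = - const a" "const (a - b) = const a - const b"
  by (simp_all add: const_def one_pCons)

lemma const_eq_0_iff [simp]: "const a = 0 \<longleftrightarrow> a = 0"
  by (simp add: const_def)

lemma const_of_nat: "const (of_nat n) = of_nat n"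
  by (induction n) (simp_all add: const_simps)

lemma const_numeral: "const (numeral n) = numeral n"
  using const_of_nat[of "numeral n"] by simp

lemma partial_const [simp]:
  "partial_x (const c) = 0" "partial_y (const c) = 0" "partial_z (const c) = 0"
  by (simp_all add: partial_x_def partial_y_def partial_z_def const_def map_poly_pCons pderiv_pCons)

lemma partial_var [simp]:
  "partial_x var_x = 1" "partial_y var_x = 0" "partial_z var_x = 0"
  "partial_x var_y = 0" "partial_y var_y = 1" "partial_z var_y = 0"
  "partial_x var_z = 0" "partial_y var_z = 0" "partial_z var_z = 1"
  by (simp_all add: partial_x_def partial_y_def partial_z_def var_x_def var_y_def var_z_def
      map_poly_pCons pderiv_pCons one_pCons)

lemma evalS_simps [simp]:
  "evalS (P + Q) v = evalS P v + evalS Q v"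
  "evalS (P - Q) v = evalS P v - evalS Q v"
  "evalS (- P) v = - evalS P v"
  "evalS (P * Q) v = evalS P v * evalS Q v"
  "evalS (P ^ n) v = evalS P v ^ n"
  "evalS 0 v = 0" "evalS 1 v = 1" "evalS (numeral k) v = numeral k"
  "evalS (const c) v = c"
  "evalS var_x v = v $ 1" "evalS var_y v = v $ 2" "evalS var_z v = v $ 3"
  by (simp_all add: evalS_def const_def var_x_def var_y_def var_z_def poly_power)

text \<open>Constants and the three variables generate the ring. Identities between evaluations
  follow by this induction, without expanding nested coefficients.\<close>

lemma S_induct [case_names const var_x var_y var_z add mult]:
  assumes const: "\<And>c. R (const c)" and x: "R var_x" and y: "R var_y" and z: "R var_z"
    and add: "\<And>P Q. R P \<Longrightarrow> R Q \<Longrightarrow> R (P + Q)"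
    and mult: "\<And>P Q. R P \<Longrightarrow> R Q \<Longrightarrow> R (P * Q)"
  shows "R P"
proof -
  have R0: "R 0"
    using const[of 0] by (simp add: const_simps)
  have 1: "R [:[:r:]:]" for r
  proof (induction r)
    case (pCons c r)
    have "[:[:pCons c r:]:] = const c + var_x * [:[:r:]:]"
      by (simp add: const_def var_x_def)
    with pCons show ?case
      using const x add mult by metis
  qed (simp add: R0)
  have 2: "R [:q:]" for q
  proof (induction q)
    case (pCons r q)
    have "[:pCons r q:] = [:[:r:]:] + var_y * [:q:]"
      by (simp add: var_y_def)
    with pCons show ?case
      using 1 y add mult by metis
  qed (simp add: R0)
  show ?thesis
  proof (induction P)
    case (pCons q P)
    have "pCons q P = [:q:] + var_z * P"
      by (simp add: var_z_def)
    with pCons show ?case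
      using 2 z add mult by metis
  qed (simp add: R0)
qed

text \<open>The field is infinite, so the variables can be peeled off one at a time,
  \<open>x\<close> first with \<open>y\<close> and \<open>z\<close> specialised. In the auxiliary
  fact the infinitely many roots are images of complex numbers in a larger coefficient ring.\<close>

lemma evalS_eq_0_imp_eq_0:
  assumes "\<And>v. evalS P v = 0"
  shows "P = 0"
proof -
  have inf: "p = 0" if "inj f" "\<And>t::complex. poly p (f t) = 0" for p :: "'a::idom poly" and f
  proof (rule ccontr)
    assume "p \<noteq> 0"
    then have "finite {x. poly p x = 0}"
      by (rule poly_roots_finite)
    moreover have "range f \<subseteq> {x. poly p x = 0}"
      using that by auto
    ultimately show False
      using finite_imageD[OF finite_subset \<open>inj f\<close>] infinite_UNIV_char_0[where 'a = complex]
      by metis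
  qed
  have 1: "poly (poly P [:[:z:]:]) [:y:] = 0" for y z
  proof (rule inf)
    show "inj (id :: complex \<Rightarrow> complex)"
      by simp
    show "poly (poly (poly P [:[:z:]:]) [:y:]) (id x) = 0" for x
      using assms[of "vector [x, y, z]"] by (simp add: evalS_def)
  qed
  have 2: "poly P [:[:z:]:] = 0" for z
    by (rule inf[of "\<lambda>y. [:y:]"]) (use 1 in \<open>auto simp: inj_def\<close>)
  show ?thesis
    by (rule inf[of "\<lambda>z. [:[:z:]:]"]) (use 2 in \<open>auto simp: inj_def\<close>)
qed

section \<open>The Euler operator and homogeneity\<close>

definition euler :: "S \<Rightarrow> S" where
  "euler P = var_x * partial_x P + var_y * partial_y P + var_z * partial_z P"

lemma coeff_euler:
  "coeff (coeff (coeff (euler P) k) j) i = of_nat (i + j + k) * coeff (coeff (coeff P k) j) i"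
proof -
  have "coeff (coeff (coeff (var_x * partial_x P) k) j) i = of_nat i * coeff (coeff (coeff P k) j) i"
    by (cases i) (simp_all add: var_x_def partial_x_def coeff_map_poly coeff_pderiv)
  moreover have
    "coeff (coeff (coeff (var_y * partial_y P) k) j) i = of_nat j * coeff (coeff (coeff P k) j) i"
    by (cases j) (simp_all add: var_y_def partial_y_def coeff_map_poly coeff_pderiv of_nat_poly algebra_simps)
  moreover have
    "coeff (coeff (coeff (var_z * partial_z P) k) j) i = of_nat k * coeff (coeff (coeff P k) j) i"
    by (cases k) (simp_all add: var_z_def partial_z_def coeff_map_poly coeff_pderiv of_nat_poly algebra_simps)
  ultimately show ?thesis
    by (simp add: euler_def algebra_simps)
qed

text \<open>Homogeneity as an eigenvalue equation of the Euler operator: products and exact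
  quotients then follow from the product rule. The weight is complex so that degree
  \<open>k - 1\<close> makes sense at \<open>k = 0\<close> too; there it is \<open>-1\<close> and
  forces the polynomial to vanish.\<close>

definition weight :: "complex \<Rightarrow> S \<Rightarrow> bool" where
  "weight w P \<longleftrightarrow> euler P = const w * P"

lemma weight_iff_coeff:
  "weight w P \<longleftrightarrow> (\<forall>i j k. coeff (coeff (coeff P k) j) i \<noteq> 0 \<longrightarrow> of_nat (i + j + k) = w)"
proof -
  have *: "coeff (coeff (coeff (const w * P) k) j) i = w * coeff (coeff (coeff P k) j) i" for i j k
    by (simp add: const_def)
  have "weight w P \<longleftrightarrow> (\<forall>i j k. of_nat (i + j + k) * coeff (coeff (coeff P k) j) i =
      w * coeff (coeff (coeff P k) j) i)"
    unfolding weight_def poly_eq_iff coeff_euler * by blast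
  also have "\<dots> \<longleftrightarrow> (\<forall>i j k. coeff (coeff (coeff P k) j) i \<noteq> 0 \<longrightarrow> of_nat (i + j + k) = w)"
    unfolding mult_cancel_right by blast
  finally show ?thesis .
qed

lemma homogeneous_iff_weight: "homogeneous d P \<longleftrightarrow> weight (of_nat d) P"
  unfolding homogeneous_def weight_iff_coeff of_nat_eq_iff ..

lemma weight_eq_0:
  assumes "weight w P" and "w \<notin> range of_nat"
  shows "P = 0"
  using assms unfolding weight_iff_coeff poly_eq_iff by (metis coeff_0 rangeI)

lemma euler_add: "euler (P + Q) = euler P + euler Q"
  by (simp add: euler_def partial_x_add partial_y_add partial_z_add algebra_simps)

lemma euler_mult: "euler (P * Q) = P * euler Q + euler P * Q"
  by (simp add: euler_def partial_x_mult partial_y_mult partial_z_mult algebra_simps)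

lemma weight_add: "weight w P \<Longrightarrow> weight w Q \<Longrightarrow> weight w (P + Q)"
  by (simp add: weight_def euler_add algebra_simps)

lemma weight_mult: "weight w P \<Longrightarrow> weight w' Q \<Longrightarrow> weight (w + w') (P * Q)"
  by (simp add: weight_def euler_mult const_simps algebra_simps)

lemma weight_const: "weight 0 (const c)"
  by (simp add: weight_def euler_def const_simps)

lemma weight_0: "weight w 0"
  by (simp add: weight_iff_coeff)

lemma weight_var: "weight 1 var_x" "weight 1 var_y" "weight 1 var_z"
  by (simp_all add: weight_def euler_def const_simps)

lemma weight_minus: "weight w P \<Longrightarrow> weight w (- P)"
  using weight_mult[OF weight_const, of w P "-1"] by (simp add: const_simps)

lemma weight_diff: "weight w P \<Longrightarrow> weight w Q \<Longrightarrow> weight w (P - Q)"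
  using weight_add[of w P "- Q"] weight_minus by simp

lemma weight_cancel:
  assumes "weight w (P * Q)" and "weight w' P" and "P \<noteq> 0"
  shows "weight (w - w') Q"
proof -
  have "P * euler Q + const w' * P * Q = const w * (P * Q)"
    using assms(1,2) unfolding weight_def euler_mult by simp
  then have "P * (euler Q - const (w - w') * Q) = 0"
    by (simp add: const_simps algebra_simps)
  then show ?thesis
    using \<open>P \<noteq> 0\<close> by (simp add: weight_def)
qed

lemma homogeneous_0: "homogeneous d 0"
  by (simp add: homogeneous_def)

lemma homogeneous_const: "homogeneous 0 (const c)"
  using weight_const by (simp add: homogeneous_iff_weight)

lemma homogeneous_numeral: "homogeneous 0 (numeral k)" "homogeneous 0 1"
  using homogeneous_const[of "numeral k"] homogeneous_const[of 1] by (simp_all add: const_numeral const_simps)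

lemma homogeneous_var: "homogeneous 1 var_x" "homogeneous 1 var_y" "homogeneous 1 var_z"
  using weight_var by (simp_all add: homogeneous_iff_weight)

lemma homogeneous_add: "homogeneous d P \<Longrightarrow> homogeneous d Q \<Longrightarrow> homogeneous d (P + Q)"
  by (simp add: homogeneous_iff_weight weight_add)

lemma homogeneous_diff: "homogeneous d P \<Longrightarrow> homogeneous d Q \<Longrightarrow> homogeneous d (P - Q)"
  by (simp add: homogeneous_iff_weight weight_diff)

lemma homogeneous_minus: "homogeneous d P \<Longrightarrow> homogeneous d (- P)"
  by (simp add: homogeneous_iff_weight weight_minus)

lemma homogeneous_mult: "homogeneous d P \<Longrightarrow> homogeneous e Q \<Longrightarrow> homogeneous (d + e) (P * Q)"
  by (simp add: homogeneous_iff_weight weight_mult)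

lemma homogeneous_power: "homogeneous d P \<Longrightarrow> homogeneous (d * n) (P ^ n)"
  by (induction n) (auto simp: homogeneous_numeral intro: homogeneous_mult)

section \<open>Restriction of polynomials to affine lines\<close>

lemma evalS_along_line:
  obtains \<phi> where "\<And>s. poly \<phi> s = evalS P (u + s *s w)"
proof -
  have "\<exists>\<phi>. \<forall>s. poly \<phi> s = evalS P (u + s *s w)"
  proof (induction P rule: S_induct)
    case (const c)
    show ?case by (rule exI[of _ "[:c:]"]) simp
  next
    case var_x
    show ?case by (rule exI[of _ "[:u $ 1, w $ 1:]"]) simp
  next
    case var_y
    show ?case by (rule exI[of _ "[:u $ 2, w $ 2:]"]) simp
  next
    case var_z
    show ?case by (rule exI[of _ "[:u $ 3, w $ 3:]"]) simp
  next
    case (add P Q)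
    then obtain \<phi> \<psi> where "\<forall>s. poly \<phi> s = evalS P (u + s *s w)" "\<forall>s. poly \<psi> s = evalS Q (u + s *s w)"
      by blast
    then show ?case by (intro exI[of _ "\<phi> + \<psi>"]) simp
  next
    case (mult P Q)
    then obtain \<phi> \<psi> where "\<forall>s. poly \<phi> s = evalS P (u + s *s w)" "\<forall>s. poly \<psi> s = evalS Q (u + s *s w)"
      by blast
    then show ?case by (intro exI[of _ "\<phi> * \<psi>"]) simp
  qed
  then show ?thesis
    using that by blast
qed

text \<open>By Euler's identity the restriction \<open>\<phi>\<close> to the line through the origin
  and \<open>v\<close> satisfies \<open>s \<phi>'(s) = d \<phi>(s)\<close>; comparing coefficients
  leaves only the term of degree \<open>d\<close>.\<close>

lemma evalS_scale:
  assumes "homogeneous d P"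
  shows "evalS P (t *s v) = t ^ d * evalS P v"
proof -
  have "\<exists>\<phi>. \<forall>s. poly \<phi> s = evalS P (s *s v) \<and> s * poly (pderiv \<phi>) s = evalS (euler P) (s *s v)"
  proof (induction P rule: S_induct)
    case (const c)
    show ?case by (rule exI[of _ "[:c:]"]) (simp add: euler_def)
  next
    case var_x
    show ?case by (rule exI[of _ "[:0, v $ 1:]"]) (simp add: euler_def pderiv_pCons)
  next
    case var_y
    show ?case by (rule exI[of _ "[:0, v $ 2:]"]) (simp add: euler_def pderiv_pCons)
  next
    case var_z
    show ?case by (rule exI[of _ "[:0, v $ 3:]"]) (simp add: euler_def pderiv_pCons)
  next
    case (add P Q)
    then obtain \<phi> \<psi> where
      "\<forall>s. poly \<phi> s = evalS P (s *s v) \<and> s * poly (pderiv \<phi>) s = evalS (euler P) (s *s v)"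
      "\<forall>s. poly \<psi> s = evalS Q (s *s v) \<and> s * poly (pderiv \<psi>) s = evalS (euler Q) (s *s v)"
      by blast
    then show ?case
      by (intro exI[of _ "\<phi> + \<psi>"]) (simp add: euler_add pderiv_add algebra_simps)
  next
    case (mult P Q)
    then obtain \<phi> \<psi> where *:
      "\<And>s. poly \<phi> s = evalS P (s *s v)" "\<And>s. evalS (euler P) (s *s v) = s * poly (pderiv \<phi>) s"
      "\<And>s. poly \<psi> s = evalS Q (s *s v)" "\<And>s. evalS (euler Q) (s *s v) = s * poly (pderiv \<psi>) s"
      by metis
    show ?case
      by (intro exI[of _ "\<phi> * \<psi>"]) (simp add: euler_mult pderiv_mult * algebra_simps)
  qed
  then obtain \<phi> where \<phi>: "\<And>s. poly \<phi> s = evalS P (s *s v)"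
    "\<And>s. s * poly (pderiv \<phi>) s = evalS (euler P) (s *s v)"
    by metis
  have "euler P = const (of_nat d) * P"
    using assms by (simp add: homogeneous_iff_weight weight_def)
  then have "[:0, 1:] * pderiv \<phi> = smult (of_nat d) \<phi>"
    by (intro poly_eq_poly_eq_iff[THEN iffD1] ext) (simp add: \<phi>)
  then have c: "coeff ([:0, 1:] * pderiv \<phi>) n = of_nat d * coeff \<phi> n" for n
    by simp
  have "\<phi> = monom (coeff \<phi> d) d"
  proof (rule poly_eqI)
    fix n
    have "of_nat n * coeff \<phi> n = of_nat d * coeff \<phi> n"
      using c[of n] by (cases n) (simp_all add: coeff_pderiv)
    then show "coeff \<phi> n = coeff (monom (coeff \<phi> d) d) n"
      by auto
  qed
  then have "poly \<phi> s = coeff \<phi> d * s ^ d" for s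
    by (metis poly_monom)
  from this[of t] this[of 1] show ?thesis
    by (simp add: \<phi>)
qed

lemma poly_eq_0_if_all_but_one:
  fixes \<phi> :: "complex poly"
  assumes "\<And>s. s \<noteq> c \<Longrightarrow> poly \<phi> s = 0"
  shows "\<phi> = 0"
proof (rule ccontr)
  assume "\<phi> \<noteq> 0"
  then have "finite {s. poly \<phi> s = 0}"
    by (rule poly_roots_finite)
  then have "finite (UNIV - {c})"
    by (rule rev_finite_subset) (use assms in auto)
  then show False
    using infinite_UNIV_char_0[where 'a = complex] by simp
qed

text \<open>The direction \<open>w\<close> is the point at infinity of the line, and the coefficient
  of degree \<open>d\<close> is the value there. Exchanging \<open>u\<close> and \<open>w\<close>
  gives a polynomial \<open>\<psi>\<close> with \<open>\<phi>(s) = s^d \<psi>(1/s)\<close>.\<close>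

lemma evalS_along_line_degree:
  assumes "homogeneous d P"
  obtains \<phi> where "\<And>s. poly \<phi> s = evalS P (u + s *s w)" "degree \<phi> \<le> d" "coeff \<phi> d = evalS P w"
proof -
  obtain \<phi> where \<phi>: "\<And>s. poly \<phi> s = evalS P (u + s *s w)"
    using evalS_along_line by blast
  obtain \<psi> where \<psi>: "\<And>s. poly \<psi> s = evalS P (w + s *s u)"
    using evalS_along_line by blast
  \<comment> \<open>\<open>reflect_poly\<close> reverses \<open>\<psi>\<close> with respect to its
    actual degree, which need not be \<open>d\<close>; the monomial on the left compensates.\<close>
  have eq: "\<phi> * monom 1 (degree \<psi>) = monom 1 d * reflect_poly \<psi>"
  proof -
    have "poly (\<phi> * monom 1 (degree \<psi>) - monom 1 d * reflect_poly \<psi>) s = 0" if "s \<noteq> 0" for s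
    proof -
      have "u + s *s w = s *s (w + inverse s *s u)"
        using that by (simp add: vec_eq_iff field_simps)
      then have "evalS P (u + s *s w) = evalS P (s *s (w + inverse s *s u))"
        by (rule arg_cong)
      then have "poly \<phi> s = s ^ d * poly \<psi> (inverse s)"
        unfolding \<phi> \<psi> evalS_scale[OF assms] .
      then show ?thesis
        using that by (simp add: poly_monom poly_reflect_poly_nz)
    qed
    then have "\<phi> * monom 1 (degree \<psi>) - monom 1 d * reflect_poly \<psi> = 0"
      by (rule poly_eq_0_if_all_but_one)
    then show ?thesis
      by simp
  qed
  have coeff: "coeff \<phi> (d + n) = coeff (reflect_poly \<psi>) (degree \<psi> + n)" for n
  proof -
    have "coeff (\<phi> * monom 1 (degree \<psi>)) (d + n + degree \<psi>) = coeff \<phi> (d + n)"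
      by (simp add: mult.commute[of \<phi>] coeff_monom_mult)
    moreover have "coeff (monom 1 d * reflect_poly \<psi>) (d + n + degree \<psi>) =
        coeff (reflect_poly \<psi>) (degree \<psi> + n)"
      by (simp add: coeff_monom_mult add.commute)
    ultimately show ?thesis
      by (simp add: eq)
  qed
  show ?thesis
  proof (rule that)
    show "degree \<phi> \<le> d"
    proof (rule degree_le, intro allI impI)
      fix i assume "d < i"
      then obtain n where "i = d + Suc n"
        using less_iff_Suc_add by auto
      then show "coeff \<phi> i = 0"
        using coeff[of "Suc n"] by (simp add: coeff_reflect_poly)
    qed
    show "coeff \<phi> d = evalS P w"
      using coeff[of 0] \<psi>[of 0] by (simp add: coeff_reflect_poly poly_0_coeff_0)
  qed (rule \<phi>)
qed

section \<open>Linear forms\<close>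

definition pair3 :: "complex ^ 3 \<Rightarrow> complex ^ 3 \<Rightarrow> complex" where
  "pair3 a v = a $ 1 * v $ 1 + a $ 2 * v $ 2 + a $ 3 * v $ 3"

definition crossC :: "complex ^ 3 \<Rightarrow> complex ^ 3 \<Rightarrow> complex ^ 3" where
  "crossC a b = vector [a $ 2 * b $ 3 - a $ 3 * b $ 2,
                        a $ 3 * b $ 1 - a $ 1 * b $ 3,
                        a $ 1 * b $ 2 - a $ 2 * b $ 1]"

definition triple_product :: "complex ^ 3 \<Rightarrow> complex ^ 3 \<Rightarrow> complex ^ 3 \<Rightarrow> complex" where
  "triple_product a b c = pair3 a (crossC b c)"

lemma vec3_eq_iff: "a = b \<longleftrightarrow> a $ 1 = b $ 1 \<and> a $ 2 = b $ 2 \<and> a $ 3 = b $ 3"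
  for a b :: "'a ^ 3"
  by (simp add: vec_eq_iff forall_3)

lemma crossC_nth [simp]:
  "crossC a b $ 1 = a $ 2 * b $ 3 - a $ 3 * b $ 2"
  "crossC a b $ 2 = a $ 3 * b $ 1 - a $ 1 * b $ 3"
  "crossC a b $ 3 = a $ 1 * b $ 2 - a $ 2 * b $ 1"
  by (simp_all add: crossC_def)

lemma evalS_linear_form [simp]: "evalS (linear_form a) v = pair3 a v"
  by (simp add: linear_form_def pair3_def)

lemma pair3_simps [simp]:
  "pair3 a (v + w) = pair3 a v + pair3 a w" "pair3 a (v - w) = pair3 a v - pair3 a w"
  "pair3 a (t *s v) = t * pair3 a v" "pair3 a (- v) = - pair3 a v" "pair3 a 0 = 0"
  "pair3 (a + b) v = pair3 a v + pair3 b v" "pair3 (t *s a) v = t * pair3 a v" "pair3 0 v = 0"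
  by (simp_all add: pair3_def algebra_simps)

lemma pair3_commute: "pair3 a b = pair3 b a"
  by (simp add: pair3_def mult.commute)

lemma pair3_crossC_self [simp]: "pair3 a (crossC a b) = 0" "pair3 b (crossC a b) = 0"
  by (simp_all add: pair3_def algebra_simps)

lemma crossC_self [simp]: "crossC a a = 0" "crossC 0 a = 0" "crossC a 0 = 0"
  by (simp_all add: vec3_eq_iff)

lemma crossC_swap: "crossC a b = - crossC b a"
  by (simp add: vec3_eq_iff)

lemma crossC_eq_0_commute: "crossC a b = 0 \<longleftrightarrow> crossC b a = 0"
  by (metis crossC_swap neg_equal_0_iff_equal)

lemma triple_product_cyclic: "triple_product a b c = triple_product b c a"
  by (simp add: triple_product_def pair3_def algebra_simps)

lemma triple_product_swap: "triple_product a b c = - triple_product b a c"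
  by (simp add: triple_product_def pair3_def algebra_simps)

text \<open>Cramer's rule, written as an identity of vectors.\<close>

lemma common_zero_of_three_forms:
  assumes "triple_product a b c \<noteq> 0" "pair3 a x = 0" "pair3 b x = 0" "pair3 c x = 0"
  shows "x = 0"
proof -
  have "triple_product a b c *s x =
      pair3 a x *s crossC b c + pair3 b x *s crossC c a + pair3 c x *s crossC a b"
    by (simp add: vec3_eq_iff triple_product_def pair3_def algebra_simps)
  then show ?thesis
    using assms by simp
qed

lemma exists_pair3_eq_1:
  assumes "a \<noteq> 0"
  obtains n where "pair3 a n = 1"
proof -
  from assms consider "a $ 1 \<noteq> 0" | "a $ 2 \<noteq> 0" | "a $ 3 \<noteq> 0"
    by (auto simp: vec3_eq_iff)
  then show ?thesis
  proof cases
    case 1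
    then show ?thesis by (intro that[of "vector [1 / a $ 1, 0, 0]"]) (simp add: pair3_def)
  next
    case 2
    then show ?thesis by (intro that[of "vector [0, 1 / a $ 2, 0]"]) (simp add: pair3_def)
  next
    case 3
    then show ?thesis by (intro that[of "vector [0, 0, 1 / a $ 3]"]) (simp add: pair3_def)
  qed
qed

lemma crossC_eq_0_imp_scale:
  assumes "crossC a b = 0" and "a \<noteq> 0"
  obtains t where "b = t *s a"
proof -
  obtain n where n: "pair3 a n = 1"
    using assms(2) by (rule exists_pair3_eq_1)
  have "b $ i * a $ j = b $ j * a $ i" for i j
    using assms(1) exhaust_3[of i] exhaust_3[of j] by (auto simp: vec3_eq_iff algebra_simps)
  note minors = this
  have *: "b $ i * pair3 a n = pair3 b n * a $ i" for i
  proof -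
    have "b $ i * pair3 a n = (b $ i * a $ 1) * n $ 1 + (b $ i * a $ 2) * n $ 2 + (b $ i * a $ 3) * n $ 3"
      by (simp add: pair3_def algebra_simps)
    also have "\<dots> = (b $ 1 * a $ i) * n $ 1 + (b $ 2 * a $ i) * n $ 2 + (b $ 3 * a $ i) * n $ 3"
      by (simp only: minors[of i])
    also have "\<dots> = pair3 b n * a $ i"
      by (simp add: pair3_def algebra_simps)
    finally show ?thesis .
  qed
  have "b = pair3 b n *s a"
    using *[unfolded n] by (simp add: vec_eq_iff)
  then show ?thesis
    by (rule that)
qed

text \<open>The double cross product identity makes \<open>v\<close> parallel to
  \<open>crossC a b\<close>.\<close>

lemma common_zero_of_two_forms:
  assumes "crossC a b \<noteq> 0" "pair3 a v = 0" "pair3 b v = 0"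
  obtains t where "v = t *s crossC a b"
proof -
  have "crossC (crossC a b) v = pair3 a v *s b - pair3 b v *s a"
    by (simp add: vec3_eq_iff pair3_def algebra_simps)
  then have "crossC (crossC a b) v = 0"
    using assms(2,3) by simp
  then show ?thesis
    using crossC_eq_0_imp_scale[OF _ assms(1)] that by blast
qed

lemma crossC_eq_0_if_common_zeros:
  assumes "crossC a b \<noteq> 0" "pair3 a v = 0" "pair3 b v = 0" "pair3 a w = 0" "pair3 b w = 0"
  shows "crossC v w = 0"
proof -
  obtain s t where "v = s *s crossC a b" "w = t *s crossC a b"
    using common_zero_of_two_forms[OF assms(1-3)] common_zero_of_two_forms[OF assms(1,4,5)] by metis
  moreover have "crossC (s *s x) (t *s x) = 0" for x
    by (simp add: vec3_eq_iff algebra_simps)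
  ultimately show ?thesis
    by simp
qed

lemma linear_form_dvd_if_vanishes:
  assumes "a \<noteq> 0" and vanish: "\<And>v. pair3 a v = 0 \<Longrightarrow> evalS P v = 0"
  shows "linear_form a dvd P"
proof -
  obtain n where n: "pair3 a n = 1"
    using assms(1) by (rule exists_pair3_eq_1)
  \<comment> \<open>\<open>Q\<close> is \<open>P\<close> composed with the projection onto the plane \<open>a = 0\<close> along \<open>n\<close>.\<close>
  have "\<exists>Q. linear_form a dvd P - Q \<and> (\<forall>v. evalS Q v = evalS P (v - pair3 a v *s n))" for P
  proof (induction P rule: S_induct)
    case (const c)
    show ?case by (rule exI[of _ "const c"]) simp
  next
    case var_x
    show ?case by (rule exI[of _ "var_x - linear_form a * const (n $ 1)"]) simp
  next
    case var_y
    show ?case by (rule exI[of _ "var_y - linear_form a * const (n $ 2)"]) simp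
  next
    case var_z
    show ?case by (rule exI[of _ "var_z - linear_form a * const (n $ 3)"]) simp
  next
    case (add P1 P2)
    then obtain Q1 Q2 where
      "linear_form a dvd P1 - Q1" "\<forall>v. evalS Q1 v = evalS P1 (v - pair3 a v *s n)"
      "linear_form a dvd P2 - Q2" "\<forall>v. evalS Q2 v = evalS P2 (v - pair3 a v *s n)"
      by blast
    moreover have "P1 + P2 - (Q1 + Q2) = (P1 - Q1) + (P2 - Q2)"
      by simp
    ultimately show ?case
      by (intro exI[of _ "Q1 + Q2"]) (simp only: evalS_simps dvd_add simp_thms)
  next
    case (mult P1 P2)
    then obtain Q1 Q2 where *:
      "linear_form a dvd P1 - Q1" "\<forall>v. evalS Q1 v = evalS P1 (v - pair3 a v *s n)"
      "linear_form a dvd P2 - Q2" "\<forall>v. evalS Q2 v = evalS P2 (v - pair3 a v *s n)"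
      by blast
    have "P1 * P2 - Q1 * Q2 = (P1 - Q1) * P2 + Q1 * (P2 - Q2)"
      by (simp add: algebra_simps)
    with * show ?case
      by (intro exI[of _ "Q1 * Q2"]) (simp only: evalS_simps dvd_add dvd_mult dvd_mult2 simp_thms)
  qed
  then obtain Q where Q: "linear_form a dvd P - Q" "\<And>v. evalS Q v = evalS P (v - pair3 a v *s n)"
    by metis
  have "evalS Q v = 0" for v
    unfolding Q(2) by (rule vanish) (simp add: n)
  then have "Q = 0"
    by (rule evalS_eq_0_imp_eq_0)
  with Q(1) show ?thesis
    by simp
qed

lemma linear_form_dvd_iff:
  assumes "a \<noteq> 0"
  shows "linear_form a dvd P \<longleftrightarrow> (\<forall>v. pair3 a v = 0 \<longrightarrow> evalS P v = 0)"
proof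
  assume "linear_form a dvd P"
  then obtain Q where "P = linear_form a * Q"
    by (rule dvdE)
  then show "\<forall>v. pair3 a v = 0 \<longrightarrow> evalS P v = 0"
    by simp
next
  assume "\<forall>v. pair3 a v = 0 \<longrightarrow> evalS P v = 0"
  then show "linear_form a dvd P"
    by (intro linear_form_dvd_if_vanishes[OF assms]) simp
qed

lemma weight_linear_form: "weight 1 (linear_form a)"
proof -
  have "weight 1 (const c * v)" if "weight 1 v" for c v
    using weight_mult[OF weight_const that] by simp
  from this[OF weight_var(1)] this[OF weight_var(2)] this[OF weight_var(3)] show ?thesis
    unfolding linear_form_def by (intro weight_add)
qed

lemma homogeneous_linear_form: "homogeneous 1 (linear_form a)"
  by (simp add: homogeneous_iff_weight weight_linear_form)

lemma linear_form_eq_0_iff [simp]: "linear_form a = 0 \<longleftrightarrow> a = 0"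
proof
  assume "linear_form a = 0"
  then have "pair3 a v = 0" for v
    by (metis evalS_linear_form evalS_simps(6))
  then show "a = 0"
    using exists_pair3_eq_1 zero_neq_one by metis
qed (simp add: linear_form_def const_simps)

lemma exists_on_plane_nonzero:
  assumes "crossC a b \<noteq> 0"
  obtains u where "pair3 a u = 0" "pair3 b u = 1"
proof -
  obtain n where n: "pair3 (crossC a b) n = 1"
    using assms by (rule exists_pair3_eq_1)
  show ?thesis
  proof (rule that)
    show "pair3 b (crossC n a) = 1"
      using n by (simp add: pair3_def algebra_simps)
  qed simp
qed

text \<open>A line in the direction \<open>u\<close> inside the plane meets \<open>b = 0\<close>
  only once, so the polynomial vanishes at all but one of its points. Later arguments may thus
  divide by \<open>pair3 b v\<close>.\<close>

lemma vanishes_on_plane_by_density: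
  assumes "crossC a b \<noteq> 0"
    and vanish: "\<And>v. pair3 a v = 0 \<Longrightarrow> pair3 b v \<noteq> 0 \<Longrightarrow> evalS P v = 0"
    and v: "pair3 a v = 0"
  shows "evalS P v = 0"
proof -
  obtain u where u: "pair3 a u = 0" "pair3 b u = 1"
    using assms(1) by (rule exists_on_plane_nonzero)
  obtain \<phi> where \<phi>: "\<And>s. poly \<phi> s = evalS P (v + s *s u)"
    using evalS_along_line by blast
  have "\<phi> = 0"
  proof (rule poly_eq_0_if_all_but_one[of "- pair3 b v"])
    fix s assume "s \<noteq> - pair3 b v"
    then have "pair3 b (v + s *s u) \<noteq> 0"
      by (simp add: u add_eq_0_iff)
    then show "poly \<phi> s = 0"
      unfolding \<phi> by (intro vanish) (simp_all add: u v)
  qed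
  then show ?thesis
    using \<phi>[of 0] by simp
qed

text \<open>Primality of a linear form, seen through zero sets: on \<open>a = 0\<close> and off
  \<open>b = 0\<close> the factor \<open>P\<close> must vanish, and density does the rest.\<close>

lemma linear_form_dvd_cancel:
  assumes "crossC a b \<noteq> 0" and "linear_form a dvd linear_form b * P"
  shows "linear_form a dvd P"
proof (rule linear_form_dvd_if_vanishes)
  show "a \<noteq> 0"
    using assms(1) by auto
  then have "pair3 b v * evalS P v = 0" if "pair3 a v = 0" for v
    using assms(2) that linear_form_dvd_iff[of a "linear_form b * P"] by simp
  then show "evalS P v = 0" if "pair3 a v = 0" for v
    using vanishes_on_plane_by_density[OF assms(1), of P v] that by auto
qed

lemma linear_form_dvd_cancel_prod_list:
  assumes "\<And>b. b \<in> set bs \<Longrightarrow> crossC a b \<noteq> 0"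
    and "linear_form a dvd prod_list (map linear_form bs) * P"
  shows "linear_form a dvd P"
  using assms
proof (induction bs)
  case (Cons b bs)
  have "linear_form a dvd linear_form b * (prod_list (map linear_form bs) * P)"
    using Cons.prems(2) by (simp add: mult.assoc)
  moreover have "crossC a b \<noteq> 0"
    using Cons.prems(1)[of b] by simp
  ultimately have "linear_form a dvd prod_list (map linear_form bs) * P"
    using linear_form_dvd_cancel by blast
  moreover have "crossC a c \<noteq> 0" if "c \<in> set bs" for c
    using Cons.prems(1)[of c] that by simp
  ultimately show ?case
    by (rule Cons.IH[rotated])
qed simp

text \<open>
  The zeros are given as the intersection points of the line \<open>a = 0\<close> with the lines \<open>b = 0\<close>.
\<close>

lemma vanishes_on_plane_if_many_zeros:
  assumes hom: "homogeneous k P"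
    and B: "finite B" "k < card B"
    and cross: "\<And>b. b \<in> B \<Longrightarrow> crossC a b \<noteq> 0"
    and distinct: "\<And>b b'. b \<in> B \<Longrightarrow> b' \<in> B \<Longrightarrow> b \<noteq> b' \<Longrightarrow> triple_product a b b' \<noteq> 0"
    and zero: "\<And>b v. b \<in> B \<Longrightarrow> pair3 a v = 0 \<Longrightarrow> pair3 b v = 0 \<Longrightarrow> evalS P v = 0"
    and v: "pair3 a v = 0"
  shows "evalS P v = 0"
proof -
  obtain b0 where b0: "b0 \<in> B"
    using B by fastforce
  \<comment> \<open>The zero on \<open>b0\<close> is placed at infinity. It lowers the degree of the
    restriction below \<open>k\<close>, while the other lines still supply at least \<open>k\<close>
    finite roots.\<close>
  define w where "w = crossC a b0"
  have w: "pair3 a w = 0" "pair3 b0 w = 0" "evalS P w = 0"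
    using zero[OF b0] by (simp_all add: w_def)
  obtain u where u: "pair3 a u = 0" "pair3 b0 u = 1"
    using exists_on_plane_nonzero[OF cross[OF b0]] by blast
  obtain \<phi> where \<phi>: "\<And>s. poly \<phi> s = evalS P (u + s *s w)" "degree \<phi> \<le> k" "coeff \<phi> k = evalS P w"
    using evalS_along_line_degree[OF hom] by blast
  have bw: "pair3 b w \<noteq> 0" if "b \<in> B - {b0}" for b
    using distinct[of b b0] that b0 triple_product_swap[of b a b0]
    by (auto simp: w_def triple_product_def)
  define root where "root b = - pair3 b u / pair3 b w" for b
  have root: "pair3 b (u + root b *s w) = 0" if "b \<in> B - {b0}" for b
    using bw[OF that] by (simp add: root_def)
  have "inj_on root (B - {b0})"
  proof (rule inj_onI, rule ccontr)
    fix b b' assume b: "b \<in> B - {b0}" "b' \<in> B - {b0}" "root b = root b'" "b \<noteq> b'"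
    let ?x = "u + root b *s w"
    have "pair3 a ?x = 0" "pair3 b ?x = 0" "pair3 b' ?x = 0"
      using root[OF b(1)] root[OF b(2)] b(3) u w by simp_all
    then have "?x = 0"
      using common_zero_of_three_forms[of a b b'] distinct[of b b'] b by blast
    then have "pair3 b0 ?x = 0"
      by simp
    then show False
      using u w by simp
  qed
  then have card: "card (root ` (B - {b0})) \<ge> k"
    using B b0 by (simp add: card_image)
  have roots: "root ` (B - {b0}) \<subseteq> {s. poly \<phi> s = 0}"
    using zero root u w by (auto simp: \<phi>)
  have "\<phi> = 0"
  proof (rule ccontr)
    assume "\<phi> \<noteq> 0"
    then have "k \<le> degree \<phi>"
      using card card_mono[OF poly_roots_finite roots] card_poly_roots_bound[of \<phi>] by linarith
    then show False
      using \<phi> w \<open>\<phi> \<noteq> 0\<close> by (metis leading_coeff_0_iff le_antisym)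
  qed
  show ?thesis
  proof (rule vanishes_on_plane_by_density[OF cross[OF b0] _ v])
    fix v assume "pair3 a v = 0" "pair3 b0 v \<noteq> 0"
    \<comment> \<open>Up to scaling, every point of the plane off \<open>b0 = 0\<close> lies on the
      parametrised line.\<close>
    define x where "x = inverse (pair3 b0 v) *s v - u"
    have "pair3 a x = 0" "pair3 b0 x = 0"
      using \<open>pair3 a v = 0\<close> \<open>pair3 b0 v \<noteq> 0\<close> u by (simp_all add: x_def)
    then obtain t where "x = t *s w"
      using common_zero_of_two_forms[OF cross[OF b0]] unfolding w_def by blast
    then have "inverse (pair3 b0 v) *s v = u + t *s w"
      by (simp add: x_def algebra_simps)
    then have "evalS P (inverse (pair3 b0 v) *s v) = 0"
      using \<phi>(1)[of t] \<open>\<phi> = 0\<close> by simp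
    then show "evalS P v = 0"
      using \<open>pair3 b0 v \<noteq> 0\<close> by (simp add: evalS_scale[OF hom])
  qed
qed

text \<open>On a line, a form of degree \<open>k\<close> with \<open>k\<close> distinct known zeros
  is a constant times the product of the linear forms cutting them out, so its values at two points
  have a known ratio. The relation is cross-multiplied because \<open>p\<close> may itself be a
  zero.\<close>

lemma ratio_of_values_on_line:
  assumes hom: "homogeneous k P"
    and B: "finite B" "card B = k"
    and plane: "pair3 a p = 0" "pair3 a q = 0"
    and q: "\<And>b. b \<in> B \<Longrightarrow> pair3 b q \<noteq> 0"
    and distinct: "\<And>b b'. b \<in> B \<Longrightarrow> b' \<in> B \<Longrightarrow> b \<noteq> b' \<Longrightarrow> triple_product a b b' \<noteq> 0"
    and zero: "\<And>b v. b \<in> B \<Longrightarrow> pair3 a v = 0 \<Longrightarrow> pair3 b v = 0 \<Longrightarrow> evalS P v = 0"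
    and pq: "crossC p q \<noteq> 0"
  shows "evalS P p * (\<Prod>b\<in>B. pair3 b q) = evalS P q * (\<Prod>b\<in>B. pair3 b p)"
proof -
  obtain \<phi> where \<phi>: "\<And>s. poly \<phi> s = evalS P (p + s *s q)" "degree \<phi> \<le> k" "coeff \<phi> k = evalS P q"
    using evalS_along_line_degree[OF hom] by blast
  define root where "root b = - pair3 b p / pair3 b q" for b
  have root: "pair3 b (p + root b *s q) = 0" if "b \<in> B" for b
    using q[OF that] by (simp add: root_def)
  have inj: "inj_on root B"
  proof (rule inj_onI, rule ccontr)
    fix b b' assume b: "b \<in> B" "b' \<in> B" "root b = root b'" "b \<noteq> b'"
    let ?x = "p + root b *s q"
    have "pair3 a ?x = 0" "pair3 b ?x = 0" "pair3 b' ?x = 0"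
      using root[OF b(1)] root[OF b(2)] b(3) plane by simp_all
    then have "?x = 0"
      using common_zero_of_three_forms[of a b b'] distinct[of b b'] b by blast
    then have "p = - root b *s q"
      by (simp add: add_eq_0_iff vector_smult_lneg)
    then have "crossC p q = 0"
      by (simp add: vec3_eq_iff)
    then show False
      using pq by contradiction
  qed
  \<comment> \<open>With \<open>q\<close> at infinity, \<open>\<phi>\<close> should be
    \<open>evalS P q\<close> times the monic polynomial with the given roots. The difference has
    \<open>k\<close> roots and no term of degree \<open>k\<close>.\<close>
  define \<psi> where "\<psi> = \<phi> - smult (evalS P q) (\<Prod>b\<in>B. [:- root b, 1:])"
  have "degree (\<Prod>b\<in>B. [:- root b, 1:]) = k"
    using B by (simp add: degree_prod_eq_sum_degree)
  moreover from this have "coeff (\<Prod>b\<in>B. [:- root b, 1:]) k = 1"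
    using lead_coeff_prod[of "\<lambda>b. [:- root b, 1:]" B] by simp
  ultimately have "degree \<psi> \<le> k" "coeff \<psi> k = 0"
    using \<phi> unfolding \<psi>_def by (auto intro!: degree_diff_le)
  have "\<psi> = 0"
  proof (rule ccontr)
    assume "\<psi> \<noteq> 0"
    have "poly \<psi> (root b) = 0" if "b \<in> B" for b
      using that B zero[OF that _ root[OF that]] plane
      by (auto simp: \<psi>_def \<phi> poly_prod prod_zero_iff)
    then have "card (root ` B) \<le> card {s. poly \<psi> s = 0}"
      using \<open>\<psi> \<noteq> 0\<close> by (intro card_mono poly_roots_finite) auto
    then have "k \<le> degree \<psi>"
      using card_poly_roots_bound[OF \<open>\<psi> \<noteq> 0\<close>] B by (simp add: card_image[OF inj])
    then show False
      using \<open>degree \<psi> \<le> k\<close> \<open>coeff \<psi> k = 0\<close> \<open>\<psi> \<noteq> 0\<close> by (metis leading_coeff_0_iff le_antisym)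
  qed
  then have "poly \<phi> 0 = evalS P q * (\<Prod>b\<in>B. - root b)"
    unfolding \<psi>_def by (simp add: poly_prod)
  then have "evalS P p = evalS P q * (\<Prod>b\<in>B. pair3 b p / pair3 b q)"
    by (simp add: \<phi> root_def)
  then show ?thesis
    using q B by (simp add: prod_dividef)
qed

section \<open>Vector fields tangent to lines\<close>

fun der :: "S \<times> S \<times> S \<Rightarrow> S \<Rightarrow> S" where
  "der (a, b, c) P = a * partial_x P + b * partial_y P + c * partial_z P"

fun value_at :: "S \<times> S \<times> S \<Rightarrow> complex ^ 3 \<Rightarrow> complex ^ 3" where
  "value_at (a, b, c) v = vector [evalS a v, evalS b v, evalS c v]"

fun hom_field :: "nat \<Rightarrow> S \<times> S \<times> S \<Rightarrow> bool" where
  "hom_field k (a, b, c) \<longleftrightarrow> homogeneous k a \<and> homogeneous k b \<and> homogeneous k c"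

fun mult_field :: "S \<Rightarrow> S \<times> S \<times> S \<Rightarrow> S \<times> S \<times> S" where
  "mult_field h (a, b, c) = (h * a, h * b, h * c)"

fun diff_radial :: "S \<times> S \<times> S \<Rightarrow> S \<Rightarrow> S \<times> S \<times> S" where
  "diff_radial (a, b, c) h = (a - h * var_x, b - h * var_y, c - h * var_z)"

definition radial :: "S \<times> S \<times> S \<Rightarrow> bool" where
  "radial \<theta> \<longleftrightarrow> (\<exists>h. \<theta> = (h * var_x, h * var_y, h * var_z))"

text \<open>These are the logarithmic vector fields of the arrangement.\<close>

definition tangent :: "S \<times> S \<times> S \<Rightarrow> (complex ^ 3) set \<Rightarrow> bool" where
  "tangent \<theta> X \<longleftrightarrow> (\<forall>a\<in>X. linear_form a dvd der \<theta> (linear_form a))"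

text \<open>
  Up to multiples of the Euler field, \<open>D\<^sub>0(f)\<close> is the module of the fields that are tangent to
  all lines of the arrangement \<open>f = 0\<close>.
\<close>

definition has_field :: "(complex ^ 3) set \<Rightarrow> nat \<Rightarrow> bool" where
  "has_field X k \<longleftrightarrow> (\<exists>\<theta>. hom_field k \<theta> \<and> tangent \<theta> X \<and> \<not> radial \<theta>)"

definition no_field_below :: "(complex ^ 3) set \<Rightarrow> nat \<Rightarrow> bool" where
  "no_field_below X r \<longleftrightarrow> (\<forall>k<r. \<not> has_field X k)"

declare der.simps [simp del] value_at.simps [simp del]

lemma der_mult: "der \<theta> (P * Q) = P * der \<theta> Q + der \<theta> P * Q"
  by (cases \<theta>) (simp add: der.simps partial_x_mult partial_y_mult partial_z_mult algebra_simps)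

lemma der_mult_field: "der (mult_field h \<theta>) P = h * der \<theta> P"
  by (cases \<theta>) (simp add: der.simps algebra_simps)

lemma der_diff_radial: "der (diff_radial \<theta> h) P = der \<theta> P - h * euler P"
  by (cases \<theta>) (simp add: der.simps euler_def algebra_simps)

lemma euler_linear_form [simp]: "euler (linear_form a) = linear_form a"
  using weight_linear_form[of a] by (simp add: weight_def const_simps)

lemma der_linear_form:
  "der (a, b, c) (linear_form \<alpha>) = const (\<alpha> $ 1) * a + const (\<alpha> $ 2) * b + const (\<alpha> $ 3) * c"
  by (simp add: der.simps linear_form_def partial_x_add partial_y_add partial_z_add
      partial_x_mult partial_y_mult partial_z_mult mult.commute)

lemma evalS_der_linear_form [simp]: "evalS (der \<theta> (linear_form \<alpha>)) v = pair3 \<alpha> (value_at \<theta> v)"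
  by (cases \<theta>) (simp add: der_linear_form value_at.simps pair3_def)

lemma weight_der_linear_form: "hom_field k \<theta> \<Longrightarrow> weight (of_nat k) (der \<theta> (linear_form \<alpha>))"
proof (cases \<theta>)
  case (fields a b c)
  assume "hom_field k \<theta>"
  then have abc: "weight (of_nat k) a" "weight (of_nat k) b" "weight (of_nat k) c"
    by (simp_all add: fields homogeneous_iff_weight)
  have "weight w (const s * v)" if "weight w v" for s v w
    using weight_mult[OF weight_const that] by simp
  from abc[THEN this] show ?thesis
    unfolding fields der_linear_form by (intro weight_add)
qed

lemma weight_quotient_by_line:
  assumes "hom_field k \<theta>" "\<alpha> \<noteq> 0" "der \<theta> (linear_form \<alpha>) = linear_form \<alpha> * h"
  shows "weight (of_nat k - 1) h"
  using weight_cancel[of "of_nat k" "linear_form \<alpha>" h 1] weight_der_linear_form[OF assms(1), of \<alpha>] assms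
  by (simp add: weight_linear_form)

lemma hom_field_diff_radial:
  assumes "hom_field k \<theta>" "weight (of_nat k - 1) h"
  shows "hom_field k (diff_radial \<theta> h)"
proof (cases \<theta>)
  case (fields a b c)
  have "homogeneous k (h * v)" if "weight 1 v" for v
    using weight_mult[OF assms(2) that] by (simp add: homogeneous_iff_weight)
  from weight_var[THEN this] show ?thesis
    using assms(1) unfolding fields by (simp add: homogeneous_diff)
qed

lemma radial_diff_radial: "radial (diff_radial \<theta> h) \<Longrightarrow> radial \<theta>"
proof (cases \<theta>)
  case (fields a b c)
  assume "radial (diff_radial \<theta> h)"
  then obtain g where "a - h * var_x = g * var_x" "b - h * var_y = g * var_y" "c - h * var_z = g * var_z"
    by (auto simp: radial_def fields)
  then have "\<theta> = ((g + h) * var_x, (g + h) * var_y, (g + h) * var_z)"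
    by (simp add: fields algebra_simps)
  then show ?thesis
    unfolding radial_def by blast
qed

lemma radial_0: "radial (0, 0, 0)"
  unfolding radial_def by (rule exI[of _ 0]) simp

lemma radial_mult_field: "radial \<theta> \<Longrightarrow> radial (mult_field g \<theta>)"
proof -
  assume "radial \<theta>"
  then obtain h where "\<theta> = (h * var_x, h * var_y, h * var_z)"
    unfolding radial_def by blast
  then have "mult_field g \<theta> = ((g * h) * var_x, (g * h) * var_y, (g * h) * var_z)"
    by (simp add: mult.assoc)
  then show ?thesis
    unfolding radial_def by blast
qed

lemma exists_nonproportional:
  assumes "a \<noteq> 0"
  obtains i where "crossC a (axis i 1) \<noteq> 0"
proof -
  have "\<exists>i. crossC a (axis i 1) \<noteq> 0"
  proof (rule ccontr)
    assume "\<nexists>i. crossC a (axis i 1) \<noteq> 0"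
    then have "crossC a (axis 1 1) = 0" "crossC a (axis 2 1) = 0"
      by auto
    then have "a = 0"
      by (simp add: vec3_eq_iff axis_def)
    with assms show False
      by contradiction
  qed
  then show ?thesis
    using that by blast
qed

lemma linear_form_axis:
  "linear_form (axis 1 1) = var_x" "linear_form (axis 2 1) = var_y" "linear_form (axis 3 1) = var_z"
  by (simp_all add: linear_form_def axis_def const_simps)

text \<open>Some coordinate is not proportional to \<open>\<alpha>\<close>. In that component
  \<open>\<alpha>\<close> divides the coordinate times \<open>h\<close>, hence \<open>h\<close>, and
  it cancels from all three components.\<close>

lemma radial_if_radial_mult_field:
  assumes "\<alpha> \<noteq> 0" and "radial (mult_field (linear_form \<alpha>) \<theta>)"
  shows "radial \<theta>"
proof (cases \<theta>)
  case (fields a b c)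
  obtain h where h: "linear_form \<alpha> * a = h * var_x" "linear_form \<alpha> * b = h * var_y"
    "linear_form \<alpha> * c = h * var_z"
    using assms(2) by (auto simp: radial_def fields)
  obtain i where i: "crossC \<alpha> (axis i 1) \<noteq> 0"
    using assms(1) by (rule exists_nonproportional)
  have "linear_form \<alpha> dvd linear_form (axis i 1) * h"
    using h exhaust_3[of i] by (metis dvd_triv_left linear_form_axis mult.commute)
  then have "linear_form \<alpha> dvd h"
    using linear_form_dvd_cancel[OF i] by blast
  then obtain g where g: "h = linear_form \<alpha> * g"
    by (rule dvdE)
  have "linear_form \<alpha> \<noteq> 0"
    using assms(1) by simp
  moreover have "linear_form \<alpha> * a = linear_form \<alpha> * (g * var_x)"
    "linear_form \<alpha> * b = linear_form \<alpha> * (g * var_y)" "linear_form \<alpha> * c = linear_form \<alpha> * (g * var_z)"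
    using h by (simp_all add: g mult.assoc)
  ultimately have "\<theta> = (g * var_x, g * var_y, g * var_z)"
    unfolding fields mult_cancel_left by simp
  then show ?thesis
    unfolding radial_def by blast
qed

lemma has_field_mono: "has_field X k \<Longrightarrow> Y \<subseteq> X \<Longrightarrow> has_field Y k"
  unfolding has_field_def tangent_def by blast

lemma no_field_below_mono: "no_field_below X r \<Longrightarrow> X \<subseteq> Y \<Longrightarrow> no_field_below Y r"
  unfolding no_field_below_def using has_field_mono by blast

lemma no_field_below_0: "no_field_below X 0"
  by (simp add: no_field_below_def)

lemma has_field_insert:
  assumes "has_field X k" "\<alpha> \<noteq> 0"
  shows "has_field (insert \<alpha> X) (Suc k)"
proof -
  obtain a b c where \<theta>: "hom_field k (a, b, c)" "tangent (a, b, c) X" "\<not> radial (a, b, c)"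
    using assms(1) unfolding has_field_def by (metis prod_cases3)
  have "hom_field (Suc k) (mult_field (linear_form \<alpha>) (a, b, c))"
    using \<theta>(1) homogeneous_mult[OF homogeneous_linear_form] by fastforce
  moreover have "tangent (mult_field (linear_form \<alpha>) (a, b, c)) (insert \<alpha> X)"
    using \<theta>(2) unfolding tangent_def der_mult_field by auto
  moreover have "\<not> radial (mult_field (linear_form \<alpha>) (a, b, c))"
    using radial_if_radial_mult_field[OF assms(2)] \<theta>(3) by blast
  ultimately show ?thesis
    unfolding has_field_def by blast
qed

text \<open>
  If \<open>\<theta>\<close> is parallel to the Euler field along the line \<open>\<alpha> = 0\<close>, then after subtracting a multiple
  of the Euler field so that \<open>\<theta>\<close> kills the equation of another line, \<open>\<theta>\<close> vanishes on \<open>\<alpha> = 0\<close>, and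
  dividing by \<open>\<alpha>\<close> lowers the degree.
\<close>

lemma radial_if_radial_on_line:
  assumes hom: "hom_field k \<theta>" and tangent: "tangent \<theta> X" and \<beta>: "\<beta> \<in> X"
    and cross: "\<And>\<gamma>. \<gamma> \<in> X \<Longrightarrow> crossC \<alpha> \<gamma> \<noteq> 0"
    and below: "no_field_below X k"
    and parallel: "\<And>v. pair3 \<alpha> v = 0 \<Longrightarrow> crossC v (value_at \<theta> v) = 0"
  shows "radial \<theta>"
proof -
  have nz: "\<alpha> \<noteq> 0" "\<beta> \<noteq> 0"
    using cross[OF \<beta>] by auto
  obtain h where h: "der \<theta> (linear_form \<beta>) = linear_form \<beta> * h"
    using tangent \<beta> unfolding tangent_def by blast
  obtain a b c where abc: "diff_radial \<theta> h = (a, b, c)"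
    by (metis prod_cases3)
  have hom': "hom_field k (a, b, c)"
    using hom_field_diff_radial[OF hom weight_quotient_by_line[OF hom nz(2) h]] by (simp add: abc)
  have der': "der (a, b, c) P = der \<theta> P - h * euler P" for P
    unfolding abc[symmetric] der_diff_radial ..
  have val: "value_at (a, b, c) v = value_at \<theta> v - evalS h v *s v" for v
    using abc by (cases \<theta>) (auto simp: value_at.simps vec3_eq_iff)
  have "value_at (a, b, c) v = 0" if v: "pair3 \<alpha> v = 0" "pair3 \<beta> v \<noteq> 0" for v
  proof -
    have "v \<noteq> 0"
      using v by auto
    moreover have "crossC v (value_at \<theta> v - t *s v) = crossC v (value_at \<theta> v)" for t
      by (simp add: vec3_eq_iff algebra_simps)
    then have "crossC v (value_at (a, b, c) v) = 0"
      unfolding val using parallel[OF v(1)] by simp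
    ultimately obtain t where t: "value_at (a, b, c) v = t *s v"
      by (metis crossC_eq_0_imp_scale)
    \<comment> \<open>The corrected field annihilates the form \<open>\<beta>\<close>, so a radial
      value at a point with \<open>\<beta>\<close> nonzero can only be \<open>0\<close>.\<close>
    have "pair3 \<beta> (value_at (a, b, c) v) = 0"
      using h unfolding evalS_der_linear_form[symmetric] by (simp only: der') (simp add: h)
    then have "t = 0"
      using v by (simp add: t)
    then show ?thesis
      by (simp add: t)
  qed
  then have zero: "evalS a v = 0" "evalS b v = 0" "evalS c v = 0"
    if "pair3 \<alpha> v = 0" "pair3 \<beta> v \<noteq> 0" for v
    using that by (simp_all add: value_at.simps vec3_eq_iff)
  have "linear_form \<alpha> dvd P" if "\<And>v. pair3 \<alpha> v = 0 \<Longrightarrow> pair3 \<beta> v \<noteq> 0 \<Longrightarrow> evalS P v = 0" for P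
    using that
    by (intro linear_form_dvd_if_vanishes[OF nz(1)]) (rule vanishes_on_plane_by_density[OF cross[OF \<beta>]])
  then have "linear_form \<alpha> dvd a" "linear_form \<alpha> dvd b" "linear_form \<alpha> dvd c"
    using zero by simp_all
  then obtain a' b' c' where abc':
    "a = linear_form \<alpha> * a'" "b = linear_form \<alpha> * b'" "c = linear_form \<alpha> * c'"
    by (metis dvdE)
  have "weight (of_nat k - 1) P" if "weight (of_nat k) (linear_form \<alpha> * P)" for P
    using weight_cancel[OF that weight_linear_form] nz(1) by simp
  then have weight: "weight (of_nat k - 1) a'" "weight (of_nat k - 1) b'" "weight (of_nat k - 1) c'"
    using hom' by (simp_all only: hom_field.simps homogeneous_iff_weight abc')
  have abc'_mult: "(a, b, c) = mult_field (linear_form \<alpha>) (a', b', c')"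
    by (simp add: abc')
  have "radial (a', b', c')"
  proof (cases k)
    case 0
    \<comment> \<open>The quotient by \<open>\<alpha>\<close> would have degree \<open>-1\<close>,
      which only \<open>0\<close> has.\<close>
    have "(- 1 :: complex) \<noteq> of_nat n" for n
      by (simp add: complex_eq_iff)
    then have "(- 1 :: complex) \<notin> range of_nat"
      by blast
    then have "a' = 0" "b' = 0" "c' = 0"
      using weight 0 weight_eq_0 by simp_all
    then show ?thesis
      by (simp add: radial_0)
  next
    case (Suc k')
    have "hom_field k' (a', b', c')"
      using weight by (simp add: Suc homogeneous_iff_weight)
    moreover have "tangent (a', b', c') X"
      unfolding tangent_def
    proof
      fix \<gamma> assume \<gamma>: "\<gamma> \<in> X"
      have "linear_form \<gamma> dvd der \<theta> (linear_form \<gamma>) - h * linear_form \<gamma>"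
        using tangent \<gamma> unfolding tangent_def by (intro dvd_diff dvd_mult) simp_all
      then have "linear_form \<gamma> dvd der (a, b, c) (linear_form \<gamma>)"
        by (simp only: der' euler_linear_form)
      then have "linear_form \<gamma> dvd linear_form \<alpha> * der (a', b', c') (linear_form \<gamma>)"
        by (simp only: abc'_mult der_mult_field)
      moreover have "crossC \<gamma> \<alpha> \<noteq> 0"
        using cross[OF \<gamma>] crossC_eq_0_commute by blast
      ultimately show "linear_form \<gamma> dvd der (a', b', c') (linear_form \<gamma>)"
        using linear_form_dvd_cancel by blast
    qed
    ultimately show ?thesis
      using below unfolding no_field_below_def has_field_def Suc by blast
  qed
  then have "radial (diff_radial \<theta> h)"
    unfolding abc abc'_mult by (rule radial_mult_field)
  then show ?thesis
    by (rule radial_diff_radial)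
qed

text \<open>At a point of a line, tangency puts the value of the field into the plane of that line;
  two different planes through \<open>v\<close> share only one direction.\<close>

lemma parallel_at_intersection:
  assumes "tangent \<theta> X" "\<alpha> \<in> X" "\<beta> \<in> X" "crossC \<alpha> \<beta> \<noteq> 0" "pair3 \<alpha> v = 0" "pair3 \<beta> v = 0"
  shows "crossC v (value_at \<theta> v) = 0"
proof -
  have "pair3 \<gamma> (value_at \<theta> v) = 0" if "\<gamma> \<in> X" "pair3 \<gamma> v = 0" for \<gamma>
  proof -
    have "linear_form \<gamma> dvd der \<theta> (linear_form \<gamma>)"
      using assms(1) that(1) unfolding tangent_def by simp
    then obtain h where "der \<theta> (linear_form \<gamma>) = linear_form \<gamma> * h"
      by (rule dvdE)
    then have "evalS (der \<theta> (linear_form \<gamma>)) v = evalS (linear_form \<gamma> * h) v"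
      by (rule arg_cong)
    then show ?thesis
      by (simp add: that(2))
  qed
  then show ?thesis
    using assms by (intro crossC_eq_0_if_common_zeros[OF assms(4)]) simp_all
qed

text \<open>
  The cross product of \<open>\<theta>\<close> with the position vector has degree one more than \<open>\<theta>\<close> and vanishes at
  the intersection points of the line \<open>\<alpha> = 0\<close> with the arrangement.
\<close>

lemma no_field_below_insert:
  assumes below: "no_field_below X r"
    and cross: "\<And>\<gamma>. \<gamma> \<in> X \<Longrightarrow> crossC \<alpha> \<gamma> \<noteq> 0"
    and B: "B \<subseteq> X" "finite B" "r + 2 \<le> card B"
    and distinct: "\<And>b b'. b \<in> B \<Longrightarrow> b' \<in> B \<Longrightarrow> b \<noteq> b' \<Longrightarrow> triple_product \<alpha> b b' \<noteq> 0"
  shows "no_field_below (insert \<alpha> X) (Suc r)"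
  unfolding no_field_below_def has_field_def
proof (intro allI impI notI, elim exE conjE)
  fix k \<theta>
  assume k: "k < Suc r" and \<theta>: "hom_field k \<theta>" "tangent \<theta> (insert \<alpha> X)" "\<not> radial \<theta>"
  obtain a b c where abc: "\<theta> = (a, b, c)"
    by (metis prod_cases3)
  obtain \<beta> where "\<beta> \<in> B"
    using B by fastforce
  have "crossC v (value_at \<theta> v) = 0" if v: "pair3 \<alpha> v = 0" for v
  proof -
    have zero: "crossC w (value_at \<theta> w) = 0" if "\<beta> \<in> B" "pair3 \<alpha> w = 0" "pair3 \<beta> w = 0" for \<beta> w
      using parallel_at_intersection[OF \<theta>(2), of \<alpha> \<beta>] that B(1) cross by blast
    have vanish: "evalS P v = 0"
      if "homogeneous (Suc k) P" "\<And>w. crossC w (value_at \<theta> w) = 0 \<Longrightarrow> evalS P w = 0" for P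
    proof (rule vanishes_on_plane_if_many_zeros[OF that(1) B(2)])
      show "Suc k < card B"
        using B(3) k by linarith
    qed (use that(2) zero distinct cross B(1) v in auto)
    have hom: "homogeneous (Suc k) (P * Q)" if "homogeneous 1 P" "homogeneous k Q" for P Q
      using homogeneous_mult[OF that] by simp
    have "evalS (var_y * c - var_z * b) v = 0" "evalS (var_z * a - var_x * c) v = 0"
      "evalS (var_x * b - var_y * a) v = 0"
      using \<theta>(1) by (intro vanish homogeneous_diff hom homogeneous_var; simp add: abc value_at.simps vec3_eq_iff)+
    then show ?thesis
      by (simp add: abc value_at.simps vec3_eq_iff)
  qed
  moreover have "no_field_below X k"
    using below k unfolding no_field_below_def by simp
  moreover have "tangent \<theta> X"
    using \<theta>(2) unfolding tangent_def by blast
  ultimately have "radial \<theta>"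
    using radial_if_radial_on_line[OF \<theta>(1) _ _ cross] \<open>\<beta> \<in> B\<close> B(1) by blast
  with \<theta>(3) show False
    by contradiction
qed

section \<open>Syzygies of the partial derivatives as tangent fields\<close>

definition reduced :: "(complex ^ 3) list \<Rightarrow> bool" where
  "reduced as \<longleftrightarrow> 0 \<notin> set as \<and> distinct as \<and>
     (\<forall>a\<in>set as. \<forall>b\<in>set as. a \<noteq> b \<longrightarrow> crossC a b \<noteq> 0)"

lemma homogeneous_prod_linear_forms: "homogeneous (length as) (prod_list (map linear_form as))"
proof (induction as)
  case Nil
  then show ?case by (simp add: homogeneous_numeral)
next
  case (Cons a as)
  then show ?case
    using homogeneous_mult[OF homogeneous_linear_form[of a]] by fastforce
qed

text \<open>For \<open>f = a g\<close> the product rule gives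
  \<open>a \<theta>(g) + \<theta>(a) g = 0\<close>, and \<open>a\<close> is prime to all factors of
  \<open>g\<close>.\<close>

lemma tangent_if_D0:
  assumes "reduced as" and "der \<theta> (prod_list (map linear_form as)) = 0"
  shows "tangent \<theta> (set as)"
  unfolding tangent_def
proof
  fix a assume "a \<in> set as"
  then obtain xs ys where as: "as = xs @ a # ys"
    by (metis split_list)
  define g where "g = prod_list (map linear_form (xs @ ys))"
  have "prod_list (map linear_form as) = linear_form a * g"
    by (simp add: as g_def mult.left_commute)
  then have "linear_form a * der \<theta> g + der \<theta> (linear_form a) * g = 0"
    using assms(2) by (simp only: der_mult)
  then have "g * der \<theta> (linear_form a) = linear_form a * - der \<theta> g"
    by (simp add: add_eq_0_iff mult.commute)
  then have "linear_form a dvd prod_list (map linear_form (xs @ ys)) * der \<theta> (linear_form a)"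
    unfolding g_def by (rule dvdI)
  moreover have "crossC a b \<noteq> 0" if "b \<in> set (xs @ ys)" for b
    using assms(1) that by (auto simp: reduced_def as)
  ultimately show "linear_form a dvd der \<theta> (linear_form a)"
    using linear_form_dvd_cancel_prod_list by blast
qed

text \<open>The quotients \<open>\<theta>(a) / a\<close> add up, as logarithmic derivatives
  do.\<close>

lemma der_prod_of_tangent:
  assumes "hom_field k \<theta>" "tangent \<theta> (set as)" "0 \<notin> set as"
  obtains H where "der \<theta> (prod_list (map linear_form as)) = prod_list (map linear_form as) * H"
    "weight (of_nat k - 1) H"
proof -
  have "\<exists>H. der \<theta> (prod_list (map linear_form as)) = prod_list (map linear_form as) * H \<and>
      weight (of_nat k - 1) H"
    using assms(2,3)
  proof (induction as)
    case Nil
    have "der \<theta> 1 = 0"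
      using partial_const[of 1] by (cases \<theta>) (simp add: der.simps const_simps)
    then show ?case
      by (intro exI[of _ 0]) (simp add: weight_0)
  next
    case (Cons a as)
    then obtain H where H: "der \<theta> (prod_list (map linear_form as)) = prod_list (map linear_form as) * H"
      "weight (of_nat k - 1) H"
      unfolding tangent_def by auto
    obtain h where h: "der \<theta> (linear_form a) = linear_form a * h"
      using Cons.prems(1) unfolding tangent_def by auto
    have "weight (of_nat k - 1) h"
      using weight_quotient_by_line[OF assms(1) _ h] Cons.prems(2) by auto
    then show ?case
      by (intro exI[of _ "H + h"]) (simp add: der_mult H h weight_add algebra_simps)
  qed
  then show ?thesis
    using that by blast
qed

text \<open>The Euler field multiplies \<open>f\<close> by its degree, which is not
  \<open>0\<close>. So no nonzero multiple of it is a syzygy, and every tangent field becomes one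
  after subtracting a suitable multiple.\<close>

lemma D0_iff_has_field:
  assumes "reduced as" "as \<noteq> []"
  shows "(\<exists>a b c. (a, b, c) \<in> D0 (equation (map linear_form as)) \<and> (a, b, c) \<noteq> (0, 0, 0) \<and>
            homogeneous k a \<and> homogeneous k b \<and> homogeneous k c) \<longleftrightarrow> has_field (set as) k"
proof -
  let ?f = "prod_list (map linear_form as)"
  have eul: "euler ?f = const (of_nat (length as)) * ?f"
    using homogeneous_prod_linear_forms[of as] by (simp only: homogeneous_iff_weight weight_def)
  have f_nz: "?f \<noteq> 0" and n_nz: "of_nat (length as) \<noteq> (0::complex)"
    using assms by (auto simp: reduced_def prod_list_zero_iff)
  have D0: "(a, b, c) \<in> D0 (equation (map linear_form as)) \<longleftrightarrow> der (a, b, c) ?f = 0" for a b c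
    by (simp add: D0_def equation_def der.simps)
  show ?thesis
  proof
    assume "\<exists>a b c. (a, b, c) \<in> D0 (equation (map linear_form as)) \<and> (a, b, c) \<noteq> (0, 0, 0) \<and>
            homogeneous k a \<and> homogeneous k b \<and> homogeneous k c"
    then obtain a b c where abc: "der (a, b, c) ?f = 0" "(a, b, c) \<noteq> (0, 0, 0)" "hom_field k (a, b, c)"
      unfolding D0 by auto
    have "\<not> radial (a, b, c)"
    proof
      assume "radial (a, b, c)"
      then obtain h where h: "(a, b, c) = (h * var_x, h * var_y, h * var_z)"
        unfolding radial_def by blast
      have "der (a, b, c) ?f = h * euler ?f"
        unfolding h by (simp add: der.simps euler_def algebra_simps)
      then have "h = 0"
        using abc(1) f_nz n_nz by (simp add: eul)
      then show False
        using abc(2) h by simp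
    qed
    then show "has_field (set as) k"
      using tangent_if_D0[OF assms(1) abc(1)] abc(3) unfolding has_field_def by blast
  next
    assume "has_field (set as) k"
    then obtain \<theta> where \<theta>: "hom_field k \<theta>" "tangent \<theta> (set as)" "\<not> radial \<theta>"
      unfolding has_field_def by blast
    obtain H where H: "der \<theta> ?f = ?f * H" "weight (of_nat k - 1) H"
      using der_prod_of_tangent[OF \<theta>(1,2)] assms(1) unfolding reduced_def by blast
    \<comment> \<open>This multiple of the Euler field sends \<open>f\<close> to
      \<open>f * H\<close>, just as \<open>\<theta>\<close> does.\<close>
    define h where "h = const (inverse (of_nat (length as))) * H"
    have hw: "weight (of_nat k - 1) h"
      using weight_mult[OF weight_const H(2)] by (simp add: h_def)
    have "const (inverse (of_nat (length as))) * const (of_nat (length as)) = 1"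
      by (simp only: const_simps(4)[symmetric] left_inverse[OF n_nz] const_simps(2))
    moreover have "h * euler ?f =
        (const (inverse (of_nat (length as))) * const (of_nat (length as))) * (?f * H)"
      unfolding eul h_def by (simp only: ac_simps)
    ultimately have "h * euler ?f = ?f * H"
      by simp
    then have "der (diff_radial \<theta> h) ?f = 0"
      by (simp add: der_diff_radial H)
    moreover obtain a b c where abc: "diff_radial \<theta> h = (a, b, c)"
      by (metis prod_cases3)
    moreover have "diff_radial \<theta> h \<noteq> (0, 0, 0)"
      using radial_diff_radial[of \<theta> h] \<theta>(3) radial_0 by auto
    moreover have "hom_field k (diff_radial \<theta> h)"
      using hom_field_diff_radial[OF \<theta>(1) hw] .
    ultimately show "\<exists>a b c. (a, b, c) \<in> D0 (equation (map linear_form as)) \<and> (a, b, c) \<noteq> (0, 0, 0) \<and>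
            homogeneous k a \<and> homogeneous k b \<and> homogeneous k c"
      unfolding D0 by auto
  qed
qed

lemma mdr_eq:
  assumes "reduced as" "as \<noteq> []" "has_field (set as) r" "no_field_below (set as) r"
  shows "mdr (equation (map linear_form as)) = r"
  unfolding mdr_def D0_iff_has_field[OF assms(1,2)]
  using assms(3,4) by (intro Least_equality) (auto simp: no_field_below_def not_less[symmetric])

section \<open>Quotients of a tangent field by the lines\<close>

lemma crossC_nonzero_if_triple_product:
  assumes "triple_product a b c \<noteq> 0"
  shows "crossC a b \<noteq> 0"
  using assms triple_product_cyclic[of c a b] by (auto simp: triple_product_def)

text \<open>On the line \<open>e = 0\<close> the form of degree \<open>k + 2\<close> measuring how
  far \<open>\<theta>\<close> is from radial equals, up to a constant,
  \<open>m m' (h m' - h m)\<close> for two lines \<open>m\<close>, \<open>m'\<close> not concurrent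
  with \<open>e\<close>. Passing to the difference \<open>h m' - h m\<close>, of degree
  \<open>k\<close>, strips off two known zeros.\<close>

locale tangent_quotients =
  fixes k :: nat and \<theta> :: "S \<times> S \<times> S" and X :: "(complex ^ 3) set" and h :: "complex ^ 3 \<Rightarrow> S"
  assumes hom: "hom_field (Suc k) \<theta>"
    and quot: "\<And>a. a \<in> X \<Longrightarrow> der \<theta> (linear_form a) = linear_form a * h a"
    and nz: "0 \<notin> X"
begin

lemma homogeneous_h: "a \<in> X \<Longrightarrow> homogeneous k (h a)"
  using weight_quotient_by_line[OF hom _ quot, of a] nz
  by (auto simp: homogeneous_iff_weight)

lemma pair3_value_at: "a \<in> X \<Longrightarrow> pair3 a (value_at \<theta> v) = pair3 a v * evalS (h a) v"
  using arg_cong[OF quot, of a "\<lambda>P. evalS P v"] by simp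

lemma tangent: "tangent \<theta> X"
  unfolding tangent_def using quot by simp

text \<open>
  Off its own line, \<open>h a\<close> takes at an intersection point the eigenvalue of \<open>\<theta>\<close> at this point.
\<close>

lemma quotients_agree_off_point:
  assumes "\<alpha> \<in> X" "\<beta> \<in> X" "crossC \<alpha> \<beta> \<noteq> 0" "pair3 \<alpha> p = 0" "pair3 \<beta> p = 0" "p \<noteq> 0"
    and "a \<in> X" "b \<in> X" "pair3 a p \<noteq> 0" "pair3 b p \<noteq> 0"
  shows "evalS (h a) p = evalS (h b) p"
proof -
  have "crossC p (value_at \<theta> p) = 0"
    using parallel_at_intersection[OF tangent] assms by blast
  then obtain t where t: "value_at \<theta> p = t *s p"
    using assms(6) by (metis crossC_eq_0_imp_scale)
  have "evalS (h c) p = t" if "c \<in> X" "pair3 c p \<noteq> 0" for c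
    using pair3_value_at[OF that(1), of p] that(2) by (simp add: t)
  then show ?thesis
    using assms by metis
qed

lemma quotient_on_line_of_pencil:
  assumes "a \<in> X" "b \<in> X" "c \<in> X" "crossC b a \<noteq> 0" "c = s *s a + t *s b" "s \<noteq> 0" "pair3 b v = 0"
  shows "evalS (h c) v = evalS (h a) v"
proof -
  have "evalS (h c - h a) v = 0"
  proof (rule vanishes_on_plane_by_density[OF assms(4) _ assms(7)])
    fix v assume v: "pair3 b v = 0" "pair3 a v \<noteq> 0"
    have "pair3 b (value_at \<theta> v) = 0"
      using pair3_value_at[OF assms(2), of v] v(1) by simp
    then have "pair3 c (value_at \<theta> v) = s * (pair3 a v * evalS (h a) v)"
      using pair3_value_at[OF assms(1), of v] by (simp add: assms(5))
    moreover have "pair3 c (value_at \<theta> v) = s * (pair3 a v * evalS (h c) v)"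
      using pair3_value_at[OF assms(3), of v] v(1) by (simp add: assms(5) mult.assoc)
    ultimately show "evalS (h c - h a) v = 0"
      using v(2) assms(6) by simp
  qed
  then show ?thesis
    by simp
qed

lemma quotients_agree_at_triple_point:
  assumes "a \<in> X" "b \<in> X" "c \<in> X" "crossC a b \<noteq> 0" "c = s *s a + t *s b" "s \<noteq> 0" "t \<noteq> 0"
    and "pair3 a p = 0" "pair3 b p = 0"
  shows "evalS (h a) p = evalS (h b) p"
proof -
  have "evalS (h c) p = evalS (h a) p"
    using assms crossC_eq_0_commute[of a b] by (intro quotient_on_line_of_pencil[of a b c]) auto
  moreover have "evalS (h c) p = evalS (h b) p"
    using assms by (intro quotient_on_line_of_pencil[of b a c t s]) (auto simp: add.commute)
  ultimately show ?thesis
    by simp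
qed

lemma quotient_difference_vanishes:
  assumes "e \<in> X" "m \<in> X" "m' \<in> X" "b \<in> X" "triple_product e b m \<noteq> 0" "triple_product e b m' \<noteq> 0"
    "pair3 e v = 0" "pair3 b v = 0"
  shows "evalS (h m' - h m) v = 0"
proof (cases "v = 0")
  case True
  \<comment> \<open>For \<open>k = 0\<close> the difference is a constant, so its value at the
    origin is not automatically \<open>0\<close>; it is carried over from a nonzero point.\<close>
  obtain p where "pair3 e p = 0" "pair3 b p = 0" "p \<noteq> 0"
  proof (rule that[of "crossC e b"])
    show "crossC e b \<noteq> 0"
      using assms(5) by (rule crossC_nonzero_if_triple_product)
  qed simp_all
  have "pair3 m p \<noteq> 0" "pair3 m' p \<noteq> 0"
    using common_zero_of_three_forms[OF assms(5)] common_zero_of_three_forms[OF assms(6)]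
      \<open>pair3 e p = 0\<close> \<open>pair3 b p = 0\<close> \<open>p \<noteq> 0\<close> by blast+
  have "evalS (h m' - h m) p = 0"
    using quotients_agree_off_point[of e b p m' m] assms \<open>pair3 e p = 0\<close> \<open>pair3 b p = 0\<close> \<open>p \<noteq> 0\<close>
      \<open>pair3 m p \<noteq> 0\<close> \<open>pair3 m' p \<noteq> 0\<close> crossC_nonzero_if_triple_product[OF assms(5)]
    by simp
  moreover have "homogeneous k (h m' - h m)"
    using homogeneous_h assms by (intro homogeneous_diff) auto
  ultimately show ?thesis
    using evalS_scale[of k "h m' - h m" 0 p] by (simp add: True)
next
  case False
  have "pair3 m v \<noteq> 0" "pair3 m' v \<noteq> 0"
    using common_zero_of_three_forms[OF assms(5)] common_zero_of_three_forms[OF assms(6)] assms(7,8) False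
    by blast+
  moreover have "crossC e b \<noteq> 0"
    using assms(5) by (rule crossC_nonzero_if_triple_product)
  ultimately show ?thesis
    using quotients_agree_off_point[of e b v m' m] assms False by simp
qed

lemma quotient_difference_ratio:
  assumes X: "e \<in> X" "m \<in> X" "m' \<in> X" "B \<subseteq> X" and B: "finite B" "card B = k"
    and "\<And>b. b \<in> B \<Longrightarrow> triple_product e b m \<noteq> 0" "\<And>b. b \<in> B \<Longrightarrow> triple_product e b m' \<noteq> 0"
    and "\<And>b b'. b \<in> B \<Longrightarrow> b' \<in> B \<Longrightarrow> b \<noteq> b' \<Longrightarrow> triple_product e b b' \<noteq> 0"
    and "pair3 e p = 0" "pair3 e q = 0" "crossC p q \<noteq> 0" "\<And>b. b \<in> B \<Longrightarrow> pair3 b q \<noteq> 0"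
  shows "evalS (h m' - h m) p * (\<Prod>b\<in>B. pair3 b q) = evalS (h m' - h m) q * (\<Prod>b\<in>B. pair3 b p)"
proof (rule ratio_of_values_on_line[OF _ B])
  show "homogeneous k (h m' - h m)"
    using homogeneous_h X by (intro homogeneous_diff) auto
  show "evalS (h m' - h m) v = 0" if "b \<in> B" "pair3 e v = 0" "pair3 b v = 0" for b v
    using quotient_difference_vanishes[of e m m' b v] that assms by blast
qed (use assms in auto)

text \<open>Both \<open>v\<close> and its value lie in the plane \<open>e = 0\<close>, so their
  cross product is a multiple \<open>g\<close> of \<open>e\<close>. Lagrange's identity, paired with
  \<open>crossC m m'\<close>, computes \<open>g\<close>.\<close>

lemma parallel_if_quotients_agree:
  assumes X: "e \<in> X" "m \<in> X" "m' \<in> X" and "triple_product e m m' \<noteq> 0"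
    and v: "pair3 e v = 0" and "evalS (h m' - h m) v = 0"
  shows "crossC v (value_at \<theta> v) = 0"
proof -
  let ?w = "value_at \<theta> v"
  have "pair3 e ?w = 0"
    using pair3_value_at[OF X(1), of v] v by simp
  have "crossC e (crossC v ?w) = pair3 e ?w *s v - pair3 e v *s ?w"
    by (simp add: vec3_eq_iff pair3_def algebra_simps)
  then have "crossC e (crossC v ?w) = 0"
    using v \<open>pair3 e ?w = 0\<close> by simp
  moreover have "e \<noteq> 0"
    using X(1) nz by auto
  ultimately obtain g where g: "crossC v ?w = g *s e"
    by (metis crossC_eq_0_imp_scale)
  have "pair3 (crossC m m') (crossC v ?w) = pair3 m v * pair3 m' ?w - pair3 m ?w * pair3 m' v"
    by (simp add: pair3_def algebra_simps)
  also have "\<dots> = pair3 m v * pair3 m' v * evalS (h m' - h m) v"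
    using pair3_value_at[OF X(2), of v] pair3_value_at[OF X(3), of v] by (simp add: algebra_simps)
  finally have "g * triple_product e m m' = 0"
    using assms(6) by (simp only: g pair3_simps pair3_commute[of _ e] triple_product_def) simp
  then show ?thesis
    using assms(4) by (simp add: g)
qed

end

lemma obtain_tangent_quotients:
  assumes "hom_field (Suc k) \<theta>" "tangent \<theta> X" "0 \<notin> X"
  obtains h where "tangent_quotients k \<theta> X h"
proof -
  have "\<forall>a\<in>X. \<exists>h. der \<theta> (linear_form a) = linear_form a * h"
    using assms(2) unfolding tangent_def by (auto elim: dvdE)
  then obtain h where "\<forall>a\<in>X. der \<theta> (linear_form a) = linear_form a * h a"
    by metis
  then have "tangent_quotients k \<theta> X h"
    using assms by unfold_locales auto
  then show ?thesis
    by (rule that)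
qed

section \<open>The arrangements of nine lines\<close>

text \<open>Integer coordinates let the incidences of the concrete lines be decided by
  evaluation.\<close>

fun int_vec :: "int \<times> int \<times> int \<Rightarrow> complex ^ 3" where
  "int_vec (a, b, c) = vector [of_int a, of_int b, of_int c]"

fun int_cross :: "int \<times> int \<times> int \<Rightarrow> int \<times> int \<times> int \<Rightarrow> int \<times> int \<times> int" where
  "int_cross (a1, a2, a3) (b1, b2, b3) = (a2 * b3 - a3 * b2, a3 * b1 - a1 * b3, a1 * b2 - a2 * b1)"

fun int_pair :: "int \<times> int \<times> int \<Rightarrow> int \<times> int \<times> int \<Rightarrow> int" where
  "int_pair (a1, a2, a3) (b1, b2, b3) = a1 * b1 + a2 * b2 + a3 * b3"

declare int_vec.simps [simp del] int_cross.simps [simp del] int_pair.simps [simp del]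

lemma int_vec_nth [simp]:
  "int_vec (a, b, c) $ 1 = of_int a" "int_vec (a, b, c) $ 2 = of_int b" "int_vec (a, b, c) $ 3 = of_int c"
  by (simp_all add: int_vec.simps)

lemma inj_int_vec: "inj int_vec"
  by (rule injI) (auto simp: vec3_eq_iff)

lemma int_vec_eq_iff [simp]: "int_vec a = int_vec b \<longleftrightarrow> a = b"
  using inj_int_vec by (auto dest: injD)

lemma int_vec_eq_0_iff [simp]: "int_vec a = 0 \<longleftrightarrow> a = (0, 0, 0)"
  by (cases a) (auto simp: vec3_eq_iff)

lemma crossC_int_vec [simp]: "crossC (int_vec a) (int_vec b) = int_vec (int_cross a b)"
  by (cases a; cases b) (simp add: vec3_eq_iff int_cross.simps)

lemma pair3_int_vec [simp]: "pair3 (int_vec a) (int_vec b) = of_int (int_pair a b)"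
  by (cases a; cases b) (simp add: pair3_def int_pair.simps)

lemma triple_product_int_vec [simp]:
  "triple_product (int_vec a) (int_vec b) (int_vec c) = of_int (int_pair a (int_cross b c))"
  by (simp add: triple_product_def)

definition vecsA :: "(int \<times> int \<times> int) list" where
  "vecsA = [(1,0,0), (0,1,0), (1,-1,-1), (1,-1,1), (2,1,-2), (1,3,-3), (3,2,3), (1,5,5), (7,-4,-1)]"

definition vecsA' :: "(int \<times> int \<times> int) list" where
  "vecsA' = [(1,0,0), (0,1,0), (4,-5,-5), (1,-1,1), (16,13,-20), (1,3,-3), (3,2,3), (1,5,5), (7,-4,-1)]"

lemma linear_form_int_vec:
  "linear_form (int_vec (a, b, c)) =
     const (of_int a) * var_x + const (of_int b) * var_y + const (of_int c) * var_z"
  by (simp add: linear_form_def)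

lemma arrA_eq: "arrA = map linear_form (map int_vec vecsA)"
  by (simp add: arrA_def vecsA_def linear_form_int_vec const_simps const_numeral)

lemma arrA'_eq: "arrA' = map linear_form (map int_vec vecsA')"
  by (simp add: arrA'_def vecsA'_def linear_form_int_vec const_simps const_numeral)

definition int_reduced :: "(int \<times> int \<times> int) list \<Rightarrow> bool" where
  "int_reduced xs \<longleftrightarrow> (0, 0, 0) \<notin> set xs \<and> distinct xs \<and>
     (\<forall>a\<in>set xs. \<forall>b\<in>set xs. a \<noteq> b \<longrightarrow> int_cross a b \<noteq> (0, 0, 0))"

lemma reduced_int_vec: "int_reduced xs \<Longrightarrow> reduced (map int_vec xs)"
  unfolding int_reduced_def reduced_def
  by (auto simp: distinct_map inj_on_subset[OF inj_int_vec])

lemma int_reduced_vecsA: "int_reduced vecsA"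
  unfolding int_reduced_def vecsA_def by code_simp

lemma int_reduced_vecsA': "int_reduced vecsA'"
  unfolding int_reduced_def vecsA'_def by code_simp

section \<open>Lower bounds by adding lines one at a time\<close>

fun almost_generic_chain :: "(int \<times> int \<times> int) list \<Rightarrow> bool" where
  "almost_generic_chain [] \<longleftrightarrow> True"
| "almost_generic_chain (a # xs) \<longleftrightarrow> almost_generic_chain xs \<and> distinct xs \<and>
     (\<forall>x\<in>set xs. int_cross a x \<noteq> (0, 0, 0)) \<and>
     (length xs < 3 \<or> (\<exists>d\<in>set xs. \<forall>x\<in>set xs. \<forall>y\<in>set xs.
        x = y \<or> x = d \<or> y = d \<or> int_pair a (int_cross x y) \<noteq> 0))"

text \<open>The head of the list is the line added last. After dropping \<open>d\<close>, the
  \<open>m\<close> earlier lines cut it in \<open>m - 1\<close> points, exactly the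
  \<open>(m - 3) + 2\<close> needed to raise the bound from \<open>m - 3\<close>; so each new line
  may contain one triple point. With fewer than three earlier lines the claimed bound is
  \<open>0\<close>.\<close>

lemma no_field_below_almost_generic_chain:
  "almost_generic_chain xs \<Longrightarrow> no_field_below (int_vec ` set xs) (length xs - 3)"
proof (induction xs)
  case (Cons a xs)
  show ?case
  proof (cases "length xs < 3")
    case True
    then have "length (a # xs) - 3 = 0"
      by simp
    then show ?thesis
      using no_field_below_0 by metis
  next
    case False
    then obtain d where d: "d \<in> set xs" "\<And>x y. x \<in> set xs \<Longrightarrow> y \<in> set xs \<Longrightarrow>
        x = y \<or> x = d \<or> y = d \<or> int_pair a (int_cross x y) \<noteq> 0"
      using Cons.prems unfolding almost_generic_chain.simps by blast
    let ?B = "int_vec ` (set xs - {d})"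
    have "card (set xs - {d}) = length xs - 1"
      using Cons.prems d(1) by (simp add: distinct_card)
    then have "card ?B = length xs - 1"
      using card_image[OF inj_on_subset[OF inj_int_vec subset_UNIV]] by metis
    moreover have "triple_product (int_vec a) b b' \<noteq> 0" if bb': "b \<in> ?B" "b' \<in> ?B" "b \<noteq> b'" for b b'
    proof -
      obtain x y where "x \<in> set xs - {d}" "y \<in> set xs - {d}" "b = int_vec x" "b' = int_vec y"
        using bb' by blast
      then show ?thesis
        using d(2)[of x y] bb'(3) by auto
    qed
    moreover have "crossC (int_vec a) c \<noteq> 0" if "c \<in> int_vec ` set xs" for c
      using Cons.prems that by auto
    moreover have "no_field_below (int_vec ` set xs) (length xs - 3)"
      using Cons by simp
    ultimately have "no_field_below (insert (int_vec a) (int_vec ` set xs)) (Suc (length xs - 3))"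
      using False by (intro no_field_below_insert[where B = ?B]) auto
    moreover have "length (a # xs) - 3 = Suc (length xs - 3)"
      using False by simp
    ultimately show ?thesis
      by simp
  qed
qed (simp add: no_field_below_0)

text \<open>Each of the nine lines contains two triple points, so one of them has to be left out,
  here line \<open>0\<close>. Line \<open>1\<close> at the head would still have two, with lines
  \<open>2\<close>, \<open>4\<close> and with \<open>3\<close>, \<open>6\<close>. Line
  \<open>2\<close> keeps only the one with \<open>1\<close> and \<open>4\<close>, having lost that
  with \<open>0\<close> and \<open>7\<close>.\<close>

definition chain_order :: "nat list" where
  "chain_order = [2, 1, 3, 4, 5, 6, 7, 8]"

lemma length_chain_order: "length chain_order - 3 = 5"
  by (simp add: chain_order_def)

lemma almost_generic_chain_vecsA: "almost_generic_chain (map ((!) vecsA) chain_order)"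
  unfolding chain_order_def vecsA_def by code_simp

lemma almost_generic_chain_vecsA': "almost_generic_chain (map ((!) vecsA') chain_order)"
  unfolding chain_order_def vecsA'_def by code_simp

lemma no_field_below_vecsA: "no_field_below (set (map int_vec vecsA)) 5"
proof -
  have "set (map ((!) vecsA) chain_order) \<subseteq> set vecsA"
    by (auto simp: chain_order_def vecsA_def)
  then have "int_vec ` set (map ((!) vecsA) chain_order) \<subseteq> set (map int_vec vecsA)"
    unfolding set_map by (rule image_mono)
  then show ?thesis
    using no_field_below_almost_generic_chain[OF almost_generic_chain_vecsA] length_chain_order
      no_field_below_mono by (metis length_map)
qed

lemma no_field_below_vecsA'_tl: "no_field_below (set (map int_vec (tl vecsA'))) 5"
proof -
  have "set (map ((!) vecsA') chain_order) = set (tl vecsA')"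
    by (simp add: chain_order_def vecsA'_def insert_commute)
  then show ?thesis
    using no_field_below_almost_generic_chain[OF almost_generic_chain_vecsA'] length_chain_order
    by (metis length_map set_map)
qed

section \<open>The explicit field of degree 5\<close>

definition poly_of_terms :: "(int \<times> nat \<times> nat \<times> nat) list \<Rightarrow> S" where
  "poly_of_terms ts =
     (\<Sum>(c, i, j, l)\<leftarrow>ts. const (of_int c) * (var_x ^ i * (var_y ^ j * var_z ^ l)))"

lemma homogeneous_poly_of_terms:
  "\<forall>(c, i, j, l)\<in>set ts. i + j + l = d \<Longrightarrow> homogeneous d (poly_of_terms ts)"
proof (induction ts)
  case Nil
  then show ?case by (simp add: poly_of_terms_def homogeneous_0)
next
  case (Cons t ts)
  obtain c i j l where t: "t = (c, i, j, l)"
    by (metis prod_cases4)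
  have "homogeneous (0 + (1 * i + (1 * j + 1 * l))) (const (of_int c) * (var_x ^ i * (var_y ^ j * var_z ^ l)))"
    by (intro homogeneous_mult homogeneous_power homogeneous_const homogeneous_var)
  moreover have "0 + (1 * i + (1 * j + 1 * l)) = d"
    using Cons.prems by (simp add: t)
  ultimately show ?case
    using Cons homogeneous_add by (simp add: t poly_of_terms_def)
qed

text \<open>Tangency to \<open>x = 0\<close> makes the first component divisible by
  \<open>x\<close>, so a multiple of the Euler field normalises it to \<open>0\<close>; tangency to
  \<open>y = 0\<close> then puts a factor \<open>y\<close> into \<open>quintic_b\<close>. The other
  lines impose linear conditions on the coefficients, and \<open>quintic_b\<close>,
  \<open>quintic_c\<close> are a solution.\<close>

definition quintic_b :: S where
  "quintic_b = poly_of_terms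
     [(-27, 0, 1, 4), (-143, 0, 2, 3), (-9, 0, 3, 2), (75, 0, 4, 1), (4, 0, 5, 0), (248, 1, 1, 3),
      (61, 1, 2, 2), (-84, 1, 3, 1), (-5, 1, 4, 0), (-30, 2, 1, 2), (-57, 2, 2, 1), (5, 2, 3, 0),
      (-48, 3, 1, 1), (-5, 3, 2, 0), (1, 4, 1, 0)]"

definition quintic_c :: S where
  "quintic_c = poly_of_terms
     [(-15, 0, 0, 5), (-93, 0, 1, 4), (-17, 0, 2, 3), (9, 0, 3, 2), (16, 0, 5, 0), (107, 1, 0, 4),
      (26, 1, 1, 3), (73, 1, 2, 2), (30, 1, 3, 1), (-16, 1, 4, 0), (2, 2, 0, 3), (52, 2, 1, 2),
      (-11, 2, 2, 1), (-75, 2, 3, 0), (-114, 3, 0, 2), (-26, 3, 1, 1), (27, 3, 2, 0), (13, 4, 0, 1),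
      (41, 4, 1, 0), (7, 5, 0, 0)]"

lemma tangent_quintic: "tangent (0, quintic_b, quintic_c) (set (map int_vec vecsA))"
  unfolding tangent_def
proof
  fix a assume "a \<in> set (map int_vec vecsA)"
  then obtain i where i: "i \<in> set vecsA" and a: "a = int_vec i"
    by auto
  have "i \<noteq> (0, 0, 0)"
    using i int_reduced_vecsA unfolding int_reduced_def by metis
  then have "a \<noteq> 0"
    by (simp add: a)
  then show "linear_form a dvd der (0, quintic_b, quintic_c) (linear_form a)"
  proof (rule linear_form_dvd_if_vanishes)
    fix v assume v: "pair3 a v = 0"
    obtain x y z where xyz: "x = v $ 1" "y = v $ 2" "z = v $ 3"
      by blast
    have b: "evalS quintic_b v =
      y * (-27 * z^4 - 143 * y * z^3 - 9 * y^2 * z^2 + 75 * y^3 * z + 4 * y^4 + 248 * x * z^3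
         + 61 * x * y * z^2 - 84 * x * y^2 * z - 5 * x * y^3 - 30 * x^2 * z^2 - 57 * x^2 * y * z + 5 * x^2 * y^2
         - 48 * x^3 * z - 5 * x^3 * y + x^4)"
      unfolding quintic_b_def poly_of_terms_def xyz
      by (simp add: algebra_simps eval_nat_numeral)
    have c: "evalS quintic_c v =
      -15 * z^5 - 93 * y * z^4 - 17 * y^2 * z^3 + 9 * y^3 * z^2 + 16 * y^5 + 107 * x * z^4 + 26 * x * y * z^3
       + 73 * x * y^2 * z^2 + 30 * x * y^3 * z - 16 * x * y^4 + 2 * x^2 * z^3 + 52 * x^2 * y * z^2
       - 11 * x^2 * y^2 * z - 75 * x^2 * y^3 - 114 * x^3 * z^2 - 26 * x^3 * y * z + 27 * x^3 * y^2
       + 13 * x^4 * z + 41 * x^4 * y + 7 * x^5"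
      unfolding quintic_c_def poly_of_terms_def xyz
      by (simp add: algebra_simps eval_nat_numeral)
    from i consider "i = (1,0,0)" | "i = (0,1,0)" | "i = (1,-1,-1)" | "i = (1,-1,1)" | "i = (2,1,-2)"
      | "i = (1,3,-3)" | "i = (3,2,3)" | "i = (1,5,5)" | "i = (7,-4,-1)"
      unfolding vecsA_def by auto
    then have "a $ 2 * evalS quintic_b v + a $ 3 * evalS quintic_c v = 0"
    proof cases
      case 1
      then show ?thesis by (simp add: a)
    next
      case 2
      then have "y = 0" using v by (simp add: a pair3_def xyz)
      then show ?thesis by (simp add: a 2 b)
    next
      case 3
      then have eq: "x = y + z" using v by (simp add: a pair3_def xyz algebra_simps)
      show ?thesis
        unfolding b c eq by (simp add: a 3 algebra_simps eval_nat_numeral)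
    next
      case 4
      then have eq: "y = x + z" using v by (simp add: a pair3_def xyz algebra_simps)
      show ?thesis
        unfolding b c eq by (simp add: a 4 algebra_simps eval_nat_numeral)
    next
      case 5
      then have eq: "y = 2 * z - 2 * x" using v by (simp add: a pair3_def xyz algebra_simps)
      show ?thesis
        unfolding b c eq by (simp add: a 5 algebra_simps eval_nat_numeral)
    next
      case 6
      then have eq: "x = 3 * z - 3 * y" using v by (simp add: a pair3_def xyz algebra_simps)
      show ?thesis
        unfolding b c eq by (simp add: a 6 algebra_simps eval_nat_numeral)
    next
      case 7
      \<comment> \<open>The parameter \<open>t\<close> solves \<open>3 x + 2 y + 3 z = 0\<close>
        without fractions.\<close>
      define t where "t = (x + z) / 2"
      have x: "x = 2 * t - z" by (simp add: t_def field_simps)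
      have y: "y = - 3 * t" using 7 v by (simp add: a pair3_def xyz t_def field_simps add_eq_0_iff)
      show ?thesis
        unfolding b c x y by (simp add: a 7 algebra_simps eval_nat_numeral)
    next
      case 8
      then have "x + 5 * y + 5 * z = 0" using v by (simp add: a pair3_def xyz)
      then have eq: "x = - 5 * y - 5 * z" by algebra
      show ?thesis
        unfolding b c eq by (simp add: a 8 algebra_simps eval_nat_numeral)
    next
      case 9
      then have eq: "z = 7 * x - 4 * y" using v by (simp add: a pair3_def xyz algebra_simps)
      show ?thesis
        unfolding b c eq by (simp add: a 9 algebra_simps eval_nat_numeral)
    qed
    then show "evalS (der (0, quintic_b, quintic_c) (linear_form a)) v = 0"
      by (simp add: value_at.simps pair3_def)
  qed
qed

lemma has_field_vecsA: "has_field (set (map int_vec vecsA)) 5"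
proof -
  have "hom_field 5 (0, quintic_b, quintic_c)"
    unfolding hom_field.simps quintic_b_def quintic_c_def
    by (intro conjI homogeneous_0 homogeneous_poly_of_terms) simp_all
  moreover have "\<not> radial (0, quintic_b, quintic_c)"
  proof
    assume "radial (0, quintic_b, quintic_c)"
    then obtain h where "0 = h * var_x" "quintic_b = h * var_y"
      unfolding radial_def by auto
    then have "quintic_b = 0"
      by (auto simp: var_x_def)
    \<comment> \<open>The value at this point is the coefficient \<open>4\<close> of
      \<open>y^5\<close>.\<close>
    then have "evalS quintic_b (vector [0, 1, 0]) = 0"
      by simp
    then show False
      by (simp add: quintic_b_def poly_of_terms_def)
  qed
  ultimately show ?thesis
    using tangent_quintic unfolding has_field_def by blast
qed

text \<open>
  With \<open>f\<close> and \<open>g\<close> as in the proof, \<open>f p\<close> is up to sign the difference of the eigenvalues of the field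
  along and across the lines through \<open>p\<close>. Going around the triple points \<open>p0\<close>, \<open>p1\<close>, \<open>p3\<close>, \<open>p2\<close> along
  the first four lines multiplies it by a factor. This factor is \<open>1\<close> for the first arrangement, but not for the
  second one.
\<close>

lemma no_quintic_vecsA': "\<not> has_field (set (map int_vec vecsA')) 5"
proof
  let ?X = "set (map int_vec vecsA')"
  assume "has_field ?X 5"
  then have "has_field ?X (Suc 4)"
    by simp
  then obtain \<theta> where \<theta>: "hom_field (Suc 4) \<theta>" "tangent \<theta> ?X" "\<not> radial \<theta>"
    unfolding has_field_def by blast
  have nz: "0 \<notin> ?X"
    using reduced_int_vec[OF int_reduced_vecsA'] unfolding reduced_def by simp
  obtain h where "tangent_quotients 4 \<theta> ?X h"
    using obtain_tangent_quotients[OF \<theta>(1,2) nz] by blast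
  then interpret tangent_quotients 4 \<theta> ?X h .
  define l0 l1 l2 l3 l4 l5 l6 l7 l8 where l:
    "l0 = int_vec (1,0,0)" "l1 = int_vec (0,1,0)" "l2 = int_vec (4,-5,-5)" "l3 = int_vec (1,-1,1)"
    "l4 = int_vec (16,13,-20)" "l5 = int_vec (1,3,-3)" "l6 = int_vec (3,2,3)" "l7 = int_vec (1,5,5)"
    "l8 = int_vec (7,-4,-1)"
  have X: "?X = {l0, l1, l2, l3, l4, l5, l6, l7, l8}"
    by (simp add: vecsA'_def l)
  have in_X: "l0 \<in> ?X" "l1 \<in> ?X" "l2 \<in> ?X" "l3 \<in> ?X" "l4 \<in> ?X" "l5 \<in> ?X" "l6 \<in> ?X" "l7 \<in> ?X" "l8 \<in> ?X"
    unfolding X by simp_all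
  \<comment> \<open>The triple points where \<open>l0\<close> or \<open>l1\<close> meets
    \<open>l2\<close> or \<open>l3\<close>. Each vector enters two of the four relations below, so
    its scaling cancels around the cycle.\<close>
  define p0 p1 p2 p3 where p:
    "p0 = int_vec (0,1,-1)" "p1 = int_vec (0,-1,-1)" "p2 = int_vec (-5,0,-4)" "p3 = int_vec (1,0,-1)"
  note int = l p int_cross.simps int_pair.simps
  \<comment> \<open>\<open>f\<close> serves on \<open>l0\<close> and \<open>l1\<close>,
    \<open>g\<close> on \<open>l2\<close> and \<open>l3\<close>: the two lines being compared pass
    through the two triple points of the line in question, and the lines in the product cut out its
    four double points, where the difference vanishes.\<close>
  define f g where "f v = evalS (h l3 - h l2) v" and "g v = evalS (h l1 - h l0) v" for v
  have "f p0 * (\<Prod>b\<in>{l1, l4, l6, l8}. pair3 b p1) = f p1 * (\<Prod>b\<in>{l1, l4, l6, l8}. pair3 b p0)"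
    unfolding f_def by (rule quotient_difference_ratio[of l0];
      (rule in_X | simp only: insert_subset in_X empty_subsetI simp_thms | auto simp: int))
  then have e0: "f p0 * 175 = f p1 * 99"
    by (simp add: int)
  have "g p1 * (\<Prod>b\<in>{l2, l4, l7, l8}. pair3 b p3) = g p3 * (\<Prod>b\<in>{l2, l4, l7, l8}. pair3 b p1)"
    unfolding g_def by (rule quotient_difference_ratio[of l3];
      (rule in_X | simp only: insert_subset in_X empty_subsetI simp_thms | auto simp: int))
  then have e3: "g p1 * 10368 = g p3 * 3500"
    by (simp add: int)
  have "f p3 * (\<Prod>b\<in>{l0, l5, l7, l8}. pair3 b p2) = f p2 * (\<Prod>b\<in>{l0, l5, l7, l8}. pair3 b p3)"
    unfolding f_def by (rule quotient_difference_ratio[of l1];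
      (rule in_X | simp only: insert_subset in_X empty_subsetI simp_thms | auto simp: int))
  then have e1: "f p3 * 27125 = f p2 * 128"
    by (simp add: int)
  have "g p0 * (\<Prod>b\<in>{l3, l5, l6, l8}. pair3 b p2) = g p2 * (\<Prod>b\<in>{l3, l5, l6, l8}. pair3 b p0)"
    unfolding g_def by (rule quotient_difference_ratio[of l2];
      (rule in_X | simp only: insert_subset in_X empty_subsetI simp_thms | auto simp: int))
  then have e2: "g p0 * 52731 = g p2 * 36"
    by (simp add: int)
  \<comment> \<open>The third line through \<open>p0\<close> is \<open>l7 = 5 l0 - l2\<close>. The
    lines \<open>l1\<close> and \<open>l3\<close> miss \<open>p0\<close>, so both quotients give the
    eigenvalue there.\<close>
  have "evalS (h l0) p0 = evalS (h l2) p0"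
    by (rule quotients_agree_at_triple_point[of l0 l2 l7 5 "-1"]; (rule in_X | simp add: int vec3_eq_iff))
  moreover have "evalS (h l1) p0 = evalS (h l3) p0"
    by (rule quotients_agree_off_point[of l0 l2]; (rule in_X | simp add: int))
  ultimately have g0: "g p0 = f p0"
    by (simp add: f_def g_def)
  have "evalS (h l0) p1 = evalS (h l3) p1"
    by (rule quotients_agree_at_triple_point[of l0 l3 l5 4 "-3"]; (rule in_X | simp add: int vec3_eq_iff))
  moreover have "evalS (h l1) p1 = evalS (h l2) p1"
    by (rule quotients_agree_off_point[of l0 l3]; (rule in_X | simp add: int))
  ultimately have g1: "g p1 = - f p1"
    by (simp add: f_def g_def)
  have "evalS (h l1) p2 = evalS (h l2) p2"
    by (rule quotients_agree_at_triple_point[of l1 l2 l4 33 4]; (rule in_X | simp add: int vec3_eq_iff))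
  moreover have "evalS (h l0) p2 = evalS (h l3) p2"
    by (rule quotients_agree_off_point[of l1 l2]; (rule in_X | simp add: int))
  ultimately have g2: "g p2 = - f p2"
    by (simp add: f_def g_def)
  have "evalS (h l1) p3 = evalS (h l3) p3"
    by (rule quotients_agree_at_triple_point[of l1 l3 l6 5 3]; (rule in_X | simp add: int vec3_eq_iff))
  moreover have "evalS (h l0) p3 = evalS (h l2) p3"
    by (rule quotients_agree_off_point[of l1 l3]; (rule in_X | simp add: int))
  ultimately have g3: "g p3 = f p3"
    by (simp add: f_def g_def)
  \<comment> \<open>One turn around the cycle multiplies \<open>f p0\<close> by
    \<open>(175/99) (-10368/3500) (27125/128) (-36/52731) = 25/33\<close>.\<close>
  have "f p1 = 0"
    using e0 e1 e2 e3 unfolding g0 g1 g2 g3 by algebra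
  \<comment> \<open>Now \<open>p1\<close>, cut out by \<open>l3\<close>, is a fifth zero on
    \<open>l0\<close> besides the four double points, one too many for degree 4.\<close>
  have *: "evalS (h l3 - h l2) v = 0" if v: "pair3 l0 v = 0" for v
  proof (rule vanishes_on_plane_if_many_zeros[OF _ _ _ _ _ _ v, where k = 4 and B = "{l1, l3, l4, l6, l8}"])
    show "homogeneous 4 (h l3 - h l2)"
      using homogeneous_h in_X by (intro homogeneous_diff) auto
    show "evalS (h l3 - h l2) w = 0"
      if b: "b \<in> {l1, l3, l4, l6, l8}" and w: "pair3 l0 w = 0" "pair3 b w = 0" for b w
    proof (cases "b = l3")
      case True
      have "crossC p1 w = 0"
        by (rule crossC_eq_0_if_common_zeros[of l0 l3]) (use w in \<open>simp_all add: True\<close>, simp_all add: int)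
      then obtain t where "w = t *s p1"
        by (rule crossC_eq_0_imp_scale) (simp add: int)
      then show ?thesis
        using \<open>f p1 = 0\<close> \<open>homogeneous 4 (h l3 - h l2)\<close> by (simp only: evalS_scale f_def) simp
    next
      case False
      show ?thesis
      proof (rule quotient_difference_vanishes[of l0 l2 l3 b])
        show "b \<in> ?X"
          using b in_X by blast
        show "triple_product l0 b l2 \<noteq> 0" "triple_product l0 b l3 \<noteq> 0"
          using b False by (auto simp: int)
      qed (rule in_X w)+
    qed
  qed (auto simp: int)
  have parallel: "crossC v (value_at \<theta> v) = 0" if "pair3 l0 v = 0" for v
    by (rule parallel_if_quotients_agree[of l0 l2 l3]; (rule in_X that *[OF that] | simp add: int))
  have "radial \<theta>"
  proof (rule radial_if_radial_on_line)
    show "hom_field 5 \<theta>"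
      using \<theta>(1) by simp
    show "tangent \<theta> (set (map int_vec (tl vecsA')))"
      using tangent unfolding tangent_def by (auto simp: vecsA'_def)
    show "no_field_below (set (map int_vec (tl vecsA'))) 5"
      by (rule no_field_below_vecsA'_tl)
    show "l1 \<in> set (map int_vec (tl vecsA'))"
      by (simp add: l vecsA'_def)
    show "crossC l0 \<gamma> \<noteq> 0" if "\<gamma> \<in> set (map int_vec (tl vecsA'))" for \<gamma>
      using that by (auto simp: vecsA'_def int)
  qed (rule parallel)
  with \<theta>(3) show False
    by contradiction
qed

lemma no_field_below_vecsA': "no_field_below (set (map int_vec vecsA')) 6"
proof -
  have "no_field_below (set (map int_vec vecsA')) 5"
    by (rule no_field_below_mono[OF no_field_below_vecsA'_tl]) (auto simp: vecsA'_def)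
  then show ?thesis
    unfolding no_field_below_def
  proof (intro allI impI)
    fix k :: nat
    assume below: "\<forall>k<5. \<not> has_field (set (map int_vec vecsA')) k" and "k < 6"
    then have "k < 5 \<or> k = 5"
      by linarith
    then show "\<not> has_field (set (map int_vec vecsA')) k"
      using below no_quintic_vecsA' by auto
  qed
qed

lemma has_field_union:
  assumes "has_field X k" "finite Y" "0 \<notin> Y"
  shows "has_field (Y \<union> X) (k + card Y)"
  using assms(2,3)
proof (induction Y)
  case empty
  then show ?case using assms(1) by simp
next
  case (insert a Y)
  then show ?case
    using has_field_insert[of "Y \<union> X" "k + card Y" a] by simp
qed

text \<open>The constant field in the direction of the triple point \<open>(0 : 1 : -1)\<close> is tangent to the three
  lines through this point.\<close>

lemma has_field_vecsA': "has_field (set (map int_vec vecsA')) 6"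
proof -
  let ?through = "{int_vec (1,0,0), int_vec (4,-5,-5), int_vec (1,5,5)}"
  let ?others = "{int_vec (0,1,0), int_vec (1,-1,1), int_vec (16,13,-20), int_vec (1,3,-3),
                  int_vec (3,2,3), int_vec (7,-4,-1)}"
  have "\<not> radial (0, 1, - 1)"
    by (auto simp: radial_def var_x_def)
  moreover have "hom_field 0 (0, 1, - 1)"
    by (simp add: homogeneous_0 homogeneous_numeral homogeneous_minus)
  moreover have "tangent (0, 1, - 1) ?through"
    by (simp add: tangent_def der_linear_form const_simps const_numeral)
  ultimately have "has_field ?through 0"
    unfolding has_field_def by blast
  \<comment> \<open>Each of the six lines not through the point costs one degree.\<close>
  then have "has_field (?others \<union> ?through) (0 + card ?others)"
    by (rule has_field_union) auto
  moreover have "card ?others = 6"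
    by simp
  moreover have "?others \<union> ?through = set (map int_vec vecsA')"
    by (auto simp: vecsA'_def)
  ultimately show ?thesis
    by simp
qed

section \<open>Intersection lattices\<close>

lemma span_singleton_eq: "vec.span {v} = range (\<lambda>t. t *s v)" for v :: "complex ^ 3"
  by (rule vec.span_singleton)

lemma span_in_line_iff:
  assumes "v \<noteq> 0"
  shows "vec.span {v} \<in> line (linear_form a) \<longleftrightarrow> pair3 a v = 0"
proof
  assume "vec.span {v} \<in> line (linear_form a)"
  then have "evalS (linear_form a) v = 0"
    unfolding line_def using vec.span_base[of v "{v}"] by blast
  then show "pair3 a v = 0"
    by simp
next
  assume "pair3 a v = 0"
  then show "vec.span {v} \<in> line (linear_form a)"
    using assms unfolding line_def proj_plane_def span_singleton_eq by auto
qed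

lemma line_subset_proj_plane: "line l \<subseteq> proj_plane"
  by (auto simp: line_def)

lemma span_eq_if_crossC:
  assumes "crossC v w = 0" "v \<noteq> 0" "w \<noteq> 0"
  shows "vec.span {v} = vec.span {w}"
proof -
  obtain t where t: "w = t *s v"
    using assms by (metis crossC_eq_0_imp_scale)
  then have "t \<noteq> 0"
    using assms(3) by auto
  have "c *s v \<in> range (\<lambda>s. s *s w)" for c
    using \<open>t \<noteq> 0\<close> by (intro image_eqI[of _ _ "c / t"]) (simp_all add: t)
  moreover have "c *s w \<in> range (\<lambda>s. s *s v)" for c
    by (intro image_eqI[of _ _ "c * t"]) (simp_all add: t)
  ultimately show ?thesis
    unfolding span_singleton_eq by blast
qed

lemma line_eq_iff:
  assumes "a \<noteq> 0" "b \<noteq> 0"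
  shows "line (linear_form a) = line (linear_form b) \<longleftrightarrow> crossC a b = 0"
proof
  assume "crossC a b = 0"
  then obtain t where t: "b = t *s a"
    using assms(1) by (metis crossC_eq_0_imp_scale)
  then have "t \<noteq> 0"
    using assms(2) by auto
  then show "line (linear_form a) = line (linear_form b)"
    by (simp add: line_def t)
next
  assume eq: "line (linear_form a) = line (linear_form b)"
  show "crossC a b = 0"
  proof (rule ccontr)
    assume "crossC a b \<noteq> 0"
    then obtain u where u: "pair3 a u = 0" "pair3 b u = 1"
      by (rule exists_on_plane_nonzero)
    then have "u \<noteq> 0"
      by auto
    then show False
      using u eq span_in_line_iff[of u a] span_in_line_iff[of u b] by simp
  qed
qed

lemma two_lines_meet:
  assumes "L \<in> dual_plane" "M \<in> dual_plane" "L \<noteq> M"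
  obtains p where "p \<in> L" "p \<in> M" "\<And>q. q \<in> L \<Longrightarrow> q \<in> M \<Longrightarrow> q = p"
proof -
  obtain a b where ab: "a \<noteq> 0" "b \<noteq> 0" "L = line (linear_form a)" "M = line (linear_form b)"
    using assms(1,2) unfolding dual_plane_def linear_forms_def by auto
  then have cross: "crossC a b \<noteq> 0"
    using assms(3) line_eq_iff by blast
  show ?thesis
  proof (rule that)
    show "vec.span {crossC a b} \<in> L" "vec.span {crossC a b} \<in> M"
      using cross by (simp_all add: ab span_in_line_iff)
    fix q assume q: "q \<in> L" "q \<in> M"
    then obtain v where v: "v \<noteq> 0" "q = vec.span {v}"
      unfolding ab line_def proj_plane_def by blast
    have "pair3 a v = 0" "pair3 b v = 0"
      using q v span_in_line_iff by (auto simp: ab)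
    then have "crossC v (crossC a b) = 0"
      by (intro crossC_eq_0_if_common_zeros[OF cross]) simp_all
    then show "q = vec.span {crossC a b}"
      unfolding v(2) using v(1) cross by (intro span_eq_if_crossC)
  qed
qed

lemma at_most_one_point:
  assumes "L \<in> dual_plane" "M \<in> dual_plane" "L \<noteq> M" "p \<in> L" "p \<in> M" "q \<in> L" "q \<in> M"
  shows "p = q"
  using two_lines_meet[OF assms(1-3)] assms(4-7) by metis

section \<open>Flats as sets of line indices\<close>

definition arrangement_of_lines :: "arrangement \<Rightarrow> bool" where
  "arrangement_of_lines A \<longleftrightarrow> distinct (map line A) \<and> set A \<subseteq> linear_forms"

definition lines_through :: "arrangement \<Rightarrow> ppoint \<Rightarrow> nat set" where
  "lines_through A p = {i. i < length A \<and> p \<in> line (A ! i)}"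

text \<open>Each multiple point is recorded by the positions of its lines. Isomorphisms match lines
  in list order, so isomorphic lattices simply have the same flats.\<close>

definition flats :: "arrangement \<Rightarrow> nat set set" where
  "flats A = lines_through A ` multiple_points A"

lemma line_nth_in_dual_plane:
  "arrangement_of_lines A \<Longrightarrow> i < length A \<Longrightarrow> line (A ! i) \<in> dual_plane"
  unfolding arrangement_of_lines_def dual_plane_def using nth_mem by blast

lemma line_nth_eq_iff:
  "arrangement_of_lines A \<Longrightarrow> i < length A \<Longrightarrow> j < length A \<Longrightarrow> line (A ! i) = line (A ! j) \<longleftrightarrow> i = j"
  unfolding arrangement_of_lines_def using nth_eq_iff_index_eq[of "map line A" i j] by simp

lemma lines_through_subset: "lines_through A p \<subseteq> {..<length A}"
  by (auto simp: lines_through_def)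

lemma finite_lines_through [simp]: "finite (lines_through A p)"
  using lines_through_subset finite_subset by blast

lemma multiplicity_at_eq:
  assumes "arrangement_of_lines A"
  shows "multiplicity_at A p = card (lines_through A p)"
proof -
  have "{L \<in> lines A. p \<in> L} = (\<lambda>i. line (A ! i)) ` lines_through A p"
    unfolding lines_def lines_through_def set_conv_nth by blast
  moreover have "inj_on (\<lambda>i. line (A ! i)) (lines_through A p)"
    using line_nth_eq_iff[OF assms] by (auto simp: inj_on_def lines_through_def)
  ultimately show ?thesis
    unfolding multiplicity_at_def by (simp add: card_image)
qed

lemma multiple_points_iff:
  assumes "arrangement_of_lines A"
  shows "p \<in> multiple_points A \<longleftrightarrow> 2 \<le> card (lines_through A p)"
proof -
  have "p \<in> proj_plane" if "2 \<le> card (lines_through A p)"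
  proof -
    have "lines_through A p \<noteq> {}"
      using that by auto
    then show ?thesis
      using line_subset_proj_plane by (auto simp: lines_through_def)
  qed
  then show ?thesis
    unfolding multiple_points_def multiplicity_at_eq[OF assms] by auto
qed

lemma two_lines_through_imp_multiple:
  assumes "arrangement_of_lines A" "i \<in> lines_through A p" "j \<in> lines_through A p" "i \<noteq> j"
  shows "p \<in> multiple_points A"
proof -
  have "card {i, j} \<le> card (lines_through A p)"
    using assms by (intro card_mono) auto
  then show ?thesis
    using assms by (simp add: multiple_points_iff)
qed

lemma multiple_point_two_lines:
  assumes "arrangement_of_lines A" "p \<in> multiple_points A"
  obtains i j where "i \<in> lines_through A p" "j \<in> lines_through A p" "i \<noteq> j"
proof -
  have "\<not> is_singleton (lines_through A p)" "lines_through A p \<noteq> {}"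
    using assms multiple_points_iff by (force simp: is_singleton_altdef)+
  then show ?thesis
    using that by (metis is_singletonI' ex_in_conv)
qed

lemma point_eq_if_two_lines_through:
  assumes "arrangement_of_lines A" "i \<noteq> j" "i \<in> lines_through A p" "j \<in> lines_through A p"
    "i \<in> lines_through A q" "j \<in> lines_through A q"
  shows "p = q"
  using assms at_most_one_point[of "line (A ! i)" "line (A ! j)" p q]
    line_nth_in_dual_plane[OF assms(1)] line_nth_eq_iff[OF assms(1)]
  by (auto simp: lines_through_def)

lemma inj_on_lines_through:
  assumes "arrangement_of_lines A"
  shows "inj_on (lines_through A) (multiple_points A)"
proof (rule inj_onI)
  fix p q assume "p \<in> multiple_points A" "lines_through A p = lines_through A q"
  then show "p = q"
    using multiple_point_two_lines[OF assms] point_eq_if_two_lines_through[OF assms] by metis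
qed

lemma flats_subset: "K \<in> flats A \<Longrightarrow> K \<subseteq> {..<length A}"
  using lines_through_subset by (auto simp: flats_def)

lemma finite_flats: "finite (flats A)"
proof (rule finite_subset)
  show "flats A \<subseteq> Pow {..<length A}"
    using flats_subset by blast
qed simp

lemma finite_multiple_points: "arrangement_of_lines A \<Longrightarrow> finite (multiple_points A)"
  using finite_flats inj_on_lines_through finite_imageD unfolding flats_def by blast

lemma card_points_of_multiplicity:
  assumes "arrangement_of_lines A" "2 \<le> m"
  shows "card {p \<in> proj_plane. multiplicity_at A p = m} = card {K \<in> flats A. card K = m}"
proof -
  have "{K \<in> flats A. card K = m} = lines_through A ` {p \<in> proj_plane. multiplicity_at A p = m}"
    using assms(2) unfolding flats_def multiple_points_def multiplicity_at_eq[OF assms(1)] by auto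
  moreover have "inj_on (lines_through A) {p \<in> proj_plane. multiplicity_at A p = m}"
    using assms(2) by (intro inj_on_subset[OF inj_on_lines_through[OF assms(1)]])
      (auto simp: multiple_points_def)
  ultimately show ?thesis
    by (simp add: card_image)
qed

lemma lattices_isomorphic_if_flats_eq:
  assumes A: "arrangement_of_lines A" and B: "arrangement_of_lines B"
    and len: "length A = length B" and flats: "flats A = flats B"
  shows "lattices_isomorphic A B"
proof -
  \<comment> \<open>Lines are matched by position, points by their sets of positions.\<close>
  define \<phi> where "\<phi> L = line (B ! (THE i. i < length A \<and> line (A ! i) = L))" for L
  define \<psi> where "\<psi> = inv_into (multiple_points B) (lines_through B) \<circ> lines_through A"
  have \<phi>: "\<phi> (line (A ! i)) = line (B ! i)" if "i < length A" for i
  proof -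
    have "(THE j. j < length A \<and> line (A ! j) = line (A ! i)) = i"
      using that line_nth_eq_iff[OF A] by (intro the_equality) auto
    then show ?thesis
      by (simp add: \<phi>_def)
  qed
  have map: "map \<phi> (map line A) = map line B"
    using \<phi> len by (intro nth_equalityI) auto
  have "inj_on \<phi> (lines A)"
    using \<phi> line_nth_eq_iff[OF B] len by (auto simp: inj_on_def lines_def in_set_conv_nth)
  moreover have "\<phi> ` lines A = lines B"
    using arg_cong[OF map, of set] by (simp add: lines_def image_image)
  ultimately have bij_\<phi>: "bij_betw \<phi> (lines A) (lines B)"
    by (simp add: bij_betw_def)
  have "bij_betw (lines_through A) (multiple_points A) (flats A)"
    by (simp add: bij_betw_def inj_on_lines_through[OF A] flats_def)
  moreover have "bij_betw (lines_through B) (multiple_points B) (flats A)"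
    unfolding flats by (simp add: bij_betw_def inj_on_lines_through[OF B] flats_def)
  ultimately have bij_\<psi>: "bij_betw \<psi> (multiple_points A) (multiple_points B)"
    unfolding \<psi>_def by (intro bij_betw_trans[OF _ bij_betw_inv_into])
  have \<psi>: "lines_through B (\<psi> p) = lines_through A p" if "p \<in> multiple_points A" for p
  proof -
    have "lines_through A p \<in> lines_through B ` multiple_points B"
      using that flats by (auto simp: flats_def)
    then show ?thesis
      by (simp add: \<psi>_def f_inv_into_f)
  qed
  have "p \<in> L \<longleftrightarrow> \<psi> p \<in> \<phi> L" if L: "L \<in> lines A" and p: "p \<in> multiple_points A" for L p
  proof -
    obtain i where i: "i < length A" "L = line (A ! i)"
      using L by (auto simp: lines_def in_set_conv_nth)
    have "p \<in> L \<longleftrightarrow> i \<in> lines_through A p" "\<psi> p \<in> \<phi> L \<longleftrightarrow> i \<in> lines_through B (\<psi> p)"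
      using i \<phi> len by (simp_all add: lines_through_def)
    then show ?thesis
      using \<psi>[OF p] by simp
  qed
  then have "ordered_lattice_iso A B \<phi> \<psi>"
    using bij_\<phi> bij_\<psi> map by (simp add: ordered_lattice_iso_def lattice_iso_def)
  then show ?thesis
    unfolding lattices_isomorphic_def by blast
qed

lemma lines_through_corresponding_points:
  assumes "corresponding_points A B p q"
  shows "lines_through A p = lines_through B q"
proof -
  obtain \<phi> \<psi> where iso: "ordered_lattice_iso A B \<phi> \<psi>" "p \<in> multiple_points A" "q = \<psi> p"
    using assms unfolding corresponding_points_def by blast
  then have map: "map \<phi> (map line A) = map line B"
    unfolding ordered_lattice_iso_def by blast
  then have len: "length A = length B"
    by (metis length_map)
  have "\<phi> (line (A ! i)) = line (B ! i)" if "i < length A" for i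
    using map that len by (metis length_map nth_map)
  moreover have "p \<in> line (A ! i) \<longleftrightarrow> q \<in> \<phi> (line (A ! i))" if "i < length A" for i
    using iso that unfolding ordered_lattice_iso_def lattice_iso_def lines_def by simp
  ultimately show ?thesis
    using len by (auto simp: lines_through_def)
qed

lemma arrangement_of_lines_append:
  assumes "arrangement_of_lines A" "l \<in> linear_forms" "line l \<notin> lines A"
  shows "arrangement_of_lines (A @ [l])"
  using assms by (auto simp: arrangement_of_lines_def lines_def)

lemma lines_through_append:
  "lines_through (A @ [l]) q =
     (if q \<in> line l then insert (length A) (lines_through A q) else lines_through A q)"
  by (auto simp: lines_through_def nth_append less_Suc_eq)

lemma multiple_points_append:
  assumes "arrangement_of_lines A" "l \<in> linear_forms" "line l \<notin> lines A" "q \<in> multiple_points A"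
  shows "q \<in> multiple_points (A @ [l])"
proof -
  have "card (lines_through A q) \<le> card (lines_through (A @ [l]) q)"
    by (intro card_mono) (auto simp: lines_through_append)
  then show ?thesis
    using assms multiple_points_iff arrangement_of_lines_append[OF assms(1-3)] by (meson order_trans)
qed

text \<open>
  Adding a line to \<open>n\<close> others changes the flats as follows; \<open>D\<close> is the set of flats on the new line.
\<close>

definition next_flats :: "nat \<Rightarrow> nat set set \<Rightarrow> nat set set \<Rightarrow> nat set set" where
  "next_flats n F D = (F - D) \<union> insert n ` D \<union> (\<lambda>i. {i, n}) ` ({..<n} - \<Union> D)"

text \<open>A multiple point on the new line gains its index. A line through such a point meets the
  new line nowhere else; every other line meets it in a new double point.\<close>

lemma flats_append:
  assumes A: "arrangement_of_lines A" and l: "l \<in> linear_forms" "line l \<notin> lines A"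
  shows "flats (A @ [l]) =
    next_flats (length A) (flats A) (lines_through A ` {q \<in> multiple_points A. q \<in> line l})"
proof -
  let ?n = "length A" and ?M = "{q \<in> multiple_points A. q \<in> line l}"
  let ?D = "lines_through A ` ?M"
  have A': "arrangement_of_lines (A @ [l])"
    using assms by (rule arrangement_of_lines_append)
  have n: "?n \<notin> lines_through A q" for q
    using lines_through_subset by blast
  have diff: "flats A - ?D = lines_through A ` (multiple_points A - ?M)"
    unfolding flats_def using inj_on_image_set_diff[OF inj_on_lines_through[OF A]] by blast
  show ?thesis
  proof (intro equalityI subsetI)
    fix K assume "K \<in> flats (A @ [l])"
    then obtain q where q: "q \<in> multiple_points (A @ [l])" "K = lines_through (A @ [l]) q"
      unfolding flats_def by blast
    have card: "2 \<le> card (lines_through (A @ [l]) q)"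
      using q(1) multiple_points_iff[OF A'] by blast
    show "K \<in> next_flats ?n (flats A) ?D"
    proof (cases "q \<in> line l")
      case False
      then have "q \<in> multiple_points A - ?M" "K = lines_through A q"
        using card q(2) multiple_points_iff[OF A] by (auto simp: lines_through_append)
      then show ?thesis
        unfolding next_flats_def diff by blast
    next
      case True
      then have K: "K = insert ?n (lines_through A q)"
        using q(2) by (simp add: lines_through_append)
      show ?thesis
      proof (cases "q \<in> multiple_points A")
        case True
        then show ?thesis
          using \<open>q \<in> line l\<close> unfolding next_flats_def K by blast
      next
        case False
        then have "card (lines_through A q) < 2"
          using multiple_points_iff[OF A] by simp
        moreover have "2 \<le> Suc (card (lines_through A q))"
          using card n unfolding q(2)[symmetric] K by simp
        ultimately obtain i where i: "lines_through A q = {i}"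
          using card_1_singletonE[of "lines_through A q"] by fastforce
        have "i \<notin> \<Union> ?D"
        proof
          assume "i \<in> \<Union> ?D"
          then obtain q' where q': "q' \<in> multiple_points A" "q' \<in> line l" "i \<in> lines_through A q'"
            by blast
          have "i \<in> lines_through (A @ [l]) q" "?n \<in> lines_through (A @ [l]) q"
            "i \<in> lines_through (A @ [l]) q'" "?n \<in> lines_through (A @ [l]) q'"
            using q' i \<open>q \<in> line l\<close> by (auto simp: lines_through_append)
          moreover have "i \<noteq> ?n"
            using i n by blast
          ultimately have "q = q'"
            using point_eq_if_two_lines_through[OF A'] by blast
          then show False
            using False q' by blast
        qed
        moreover have "i < ?n"
          using i lines_through_subset by blast
        ultimately show ?thesis
          unfolding next_flats_def K i by (auto simp: insert_commute)
      qed
    qed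
  next
    fix K assume "K \<in> next_flats ?n (flats A) ?D"
    then consider q where "q \<in> multiple_points A" "q \<notin> line l" "K = lines_through A q"
      | q where "q \<in> multiple_points A" "q \<in> line l" "K = insert ?n (lines_through A q)"
      | i where "i < ?n" "i \<notin> \<Union> ?D" "K = {i, ?n}"
      unfolding next_flats_def diff by blast
    then show "K \<in> flats (A @ [l])"
    proof cases
      case 1
      then have "K = lines_through (A @ [l]) q"
        by (simp add: lines_through_append)
      moreover have "q \<in> multiple_points (A @ [l])"
        using 1(1) multiple_points_append[OF A l] by blast
      ultimately show ?thesis
        unfolding flats_def by blast
    next
      case 2
      then have "K = lines_through (A @ [l]) q"
        by (simp add: lines_through_append)
      moreover have "q \<in> multiple_points (A @ [l])"
        using 2(1) multiple_points_append[OF A l] by blast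
      ultimately show ?thesis
        unfolding flats_def by blast
    next
      case 3
      have "line (A ! i) \<noteq> line l"
        using 3(1) l(2) by (auto simp: lines_def)
      moreover have "line l \<in> dual_plane"
        using l(1) by (simp add: dual_plane_def)
      ultimately obtain q where q: "q \<in> line (A ! i)" "q \<in> line l"
        using two_lines_meet line_nth_in_dual_plane[OF A 3(1)] by metis
      have i: "i \<in> lines_through A q"
        using q 3(1) by (simp add: lines_through_def)
      have "lines_through A q = {i}"
      proof (rule ccontr)
        assume "lines_through A q \<noteq> {i}"
        then obtain j where "j \<in> lines_through A q" "j \<noteq> i"
          using i by blast
        then have "q \<in> multiple_points A"
          using two_lines_through_imp_multiple[OF A i] by blast
        then show False
          using i 3(2) q(2) by blast
      qed
      then have K: "lines_through (A @ [l]) q = K"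
        using q 3(3) by (auto simp: lines_through_append)
      moreover have "q \<in> multiple_points (A @ [l])"
        unfolding multiple_points_iff[OF A'] K using 3(1,3) by simp
      ultimately show ?thesis
        unfolding flats_def by blast
    qed
  qed
qed

lemma card_flats_generic:
  assumes "\<And>K. K \<in> F \<Longrightarrow> K \<subseteq> {..<n}" "finite F"
  shows "card {K \<in> next_flats n F {}. card K = 2} = card {K \<in> F. card K = 2} + n"
    and "card {K \<in> next_flats n F {}. card K = 3} = card {K \<in> F. card K = 3}"
proof -
  let ?N = "(\<lambda>i. {i, n}) ` {..<n}"
  have step: "next_flats n F {} = F \<union> ?N"
    by (simp add: next_flats_def)
  have card_N: "card K = 2" if "K \<in> ?N" for K
    using that by auto
  have "inj_on (\<lambda>i. {i, n}) {..<n}"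
    by (auto simp: inj_on_def doubleton_eq_iff)
  then have N: "card ?N = n"
    by (simp add: card_image)
  have "{K \<in> next_flats n F {}. card K = 2} = {K \<in> F. card K = 2} \<union> ?N"
    unfolding step using card_N by blast
  moreover have "{K \<in> F. card K = 2} \<inter> ?N = {}"
    using assms(1) by auto
  ultimately show "card {K \<in> next_flats n F {}. card K = 2} = card {K \<in> F. card K = 2} + n"
    using assms(2) N by (simp add: card_Un_disjoint)
  have "{K \<in> next_flats n F {}. card K = 3} = {K \<in> F. card K = 3}"
    unfolding step using card_N by auto
  then show "card {K \<in> next_flats n F {}. card K = 3} = card {K \<in> F. card K = 3}"
    by simp
qed

text \<open>The double point turns into a triple point, and each of the \<open>n - 2\<close> lines
  not through it gives a new double point, which changes the number of double points by
  \<open>(n - 2) - 1\<close>.\<close>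

lemma card_flats_through_double_point:
  assumes F: "\<And>K. K \<in> F \<Longrightarrow> K \<subseteq> {..<n}" "finite F" and I: "I \<in> F" "card I = 2"
  shows "card {K \<in> next_flats n F {I}. card K = 2} = card {K \<in> F. card K = 2} + n - 3"
    and "card {K \<in> next_flats n F {I}. card K = 3} = card {K \<in> F. card K = 3} + 1"
proof -
  let ?N = "(\<lambda>i. {i, n}) ` ({..<n} - I)"
  have step: "next_flats n F {I} = (F - {I}) \<union> {insert n I} \<union> ?N"
    by (simp add: next_flats_def)
  have card_N: "card K = 2" if "K \<in> ?N" for K
    using that by auto
  have I': "I \<subseteq> {..<n}" "finite I"
    using F(1)[OF I(1)] finite_subset by blast+
  have card_I: "card (insert n I) = 3"
    using I' I(2) by (subst card_insert_disjoint) auto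
  have "inj_on (\<lambda>i. {i, n}) ({..<n} - I)"
    by (auto simp: inj_on_def doubleton_eq_iff)
  then have N: "card ?N = n - 2"
    using I I' by (simp add: card_image card_Diff_subset)
  have "2 \<le> n"
    using card_mono[OF _ I'(1)] I(2) by simp
  have eq: "{K \<in> next_flats n F {I}. card K = 2} = ({K \<in> F. card K = 2} - {I}) \<union> ?N"
    unfolding step using card_N card_I by auto
  have "({K \<in> F. card K = 2} - {I}) \<inter> ?N = {}"
    using F(1) by auto
  then have un: "card (({K \<in> F. card K = 2} - {I}) \<union> ?N) = card ({K \<in> F. card K = 2} - {I}) + card ?N"
    using F(2) by (intro card_Un_disjoint) auto
  have diff: "card ({K \<in> F. card K = 2} - {I}) = card {K \<in> F. card K = 2} - 1"
    using I F(2) by simp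
  have "card {K \<in> F. card K = 2} \<noteq> 0"
    using I F(2) by auto
  then show "card {K \<in> next_flats n F {I}. card K = 2} = card {K \<in> F. card K = 2} + n - 3"
    unfolding eq un diff N using \<open>2 \<le> n\<close> by linarith
  have "{K \<in> next_flats n F {I}. card K = 3} = insert (insert n I) {K \<in> F. card K = 3}"
    unfolding step using card_N card_I I(2) by auto
  moreover have "insert n I \<notin> F"
    using F(1) by blast
  ultimately show "card {K \<in> next_flats n F {I}. card K = 3} = card {K \<in> F. card K = 3} + 1"
    using F(2) by simp
qed

section \<open>Existence of generic lines\<close>

lemma exists_generic_lines:
  assumes A: "arrangement_of_lines A" and len: "2 \<le> length A"
  obtains G where "generic_lines A G"
proof -
  have "\<forall>q\<in>multiple_points A. \<exists>v. v \<noteq> 0 \<and> q = vec.span {v}"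
    unfolding multiple_points_def proj_plane_def by blast
  then obtain v where v: "\<And>q. q \<in> multiple_points A \<Longrightarrow> v q \<noteq> 0 \<and> q = vec.span {v q}"
    by metis
  \<comment> \<open>In dual coordinates the lines through a point form the zero set of a linear
    form. The factor \<open>var_x\<close> makes \<open>a \<noteq> 0\<close> immediate from
    \<open>evalS P a \<noteq> 0\<close>, at the cost of discarding some more lines.\<close>
  define P where "P = var_x * (\<Prod>q\<in>multiple_points A. linear_form (v q))"
  have "homogeneous (card Q) (\<Prod>q\<in>Q. linear_form (v q))" if "finite Q" for Q
    using that
  proof (induction Q rule: finite_induct)
    case empty
    then show ?case
      by (simp add: homogeneous_numeral)
  next
    case (insert q Q)
    then show ?case
      using homogeneous_mult[OF homogeneous_linear_form[of "v q"] insert.IH] by simp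
  qed
  then have hom: "\<exists>d. homogeneous d P"
    unfolding P_def using homogeneous_mult[OF homogeneous_var(1)] finite_multiple_points[OF A] by blast
  have evalP: "evalS P a = a $ 1 * (\<Prod>q\<in>multiple_points A. pair3 (v q) a)" for a
  proof -
    have "evalS (\<Prod>q\<in>Q. linear_form (v q)) a = (\<Prod>q\<in>Q. pair3 (v q) a)" for Q
      by (induction Q rule: infinite_finite_induct) simp_all
    then show ?thesis
      by (simp add: P_def)
  qed
  define Z where "Z = {line (linear_form a) | a. a \<noteq> 0 \<and> (\<forall>P\<in>{P}. evalS P a = 0)}"
  have Z: "zariski_closed_dual Z"
    unfolding zariski_closed_dual_def Z_def using hom by (intro exI[of _ "{P}"]) blast
  have in_Z: "line (linear_form a) \<in> Z" if "a \<noteq> 0" "q \<in> multiple_points A" "q \<in> line (linear_form a)" for a q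
  proof -
    have "pair3 (v q) a = 0"
      using v[OF that(2)] that(3) span_in_line_iff pair3_commute by metis
    then have "evalS P a = 0"
      using finite_multiple_points[OF A] that(2) by (auto simp: evalP prod_zero_iff)
    then show ?thesis
      unfolding Z_def using that(1) by blast
  qed
  have avoid: "q \<notin> L" if "L \<in> dual_plane - Z" "q \<in> multiple_points A" for L q
    using that in_Z unfolding dual_plane_def linear_forms_def by blast
  have "Z \<noteq> dual_plane"
  proof
    assume "Z = dual_plane"
    have "P \<noteq> 0"
      using v finite_multiple_points[OF A] by (auto simp: P_def var_x_def)
    then obtain a where a: "evalS P a \<noteq> 0"
      using evalS_eq_0_imp_eq_0 by blast
    then have "a \<noteq> 0"
      by (auto simp: evalP)
    then have "line (linear_form a) \<in> Z"
      unfolding \<open>Z = dual_plane\<close> dual_plane_def linear_forms_def by blast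
    then obtain b where b: "b \<noteq> 0" "line (linear_form a) = line (linear_form b)" "evalS P b = 0"
      unfolding Z_def by blast
    then have "crossC b a = 0"
      using line_eq_iff[OF b(1) \<open>a \<noteq> 0\<close>] by simp
    then obtain t where "a = t *s b"
      using b(1) by (metis crossC_eq_0_imp_scale)
    moreover obtain d where "homogeneous d P"
      using hom by blast
    ultimately have "evalS P a = 0"
      using b(3) evalS_scale by simp
    then show False
      using a by contradiction
  qed
  moreover have "Z \<subseteq> dual_plane"
    unfolding Z_def dual_plane_def linear_forms_def by blast
  \<comment> \<open>With at least two lines, every line of the arrangement contains a multiple
    point, so avoiding these points excludes the lines as well.\<close>
  moreover have "L \<notin> lines A" if L: "L \<in> dual_plane - Z" for L
  proof
    assume "L \<in> lines A"
    then obtain i where i: "i < length A" "L = line (A ! i)"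
      by (auto simp: lines_def in_set_conv_nth)
    define j where "j = (if i = 0 then 1 else 0 :: nat)"
    have j: "j < length A" "j \<noteq> i"
      using len by (auto simp: j_def)
    obtain q where "q \<in> line (A ! i)" "q \<in> line (A ! j)"
      using two_lines_meet line_nth_in_dual_plane[OF A] line_nth_eq_iff[OF A] i j by metis
    then have "q \<in> multiple_points A" "q \<in> L"
      using two_lines_through_imp_multiple[OF A, of i q j] i j by (auto simp: lines_through_def)
    then show False
      using avoid[OF L] by blast
  qed
  ultimately have "generic_lines A (dual_plane - Z)"
    unfolding generic_lines_def using Z avoid by blast
  then show ?thesis
    by (rule that)
qed

text \<open>A point other than \<open>p\<close> lies on at most one line of the pencil, so the
  multiple points and the lines of the arrangement rule out finitely many members.\<close>

lemma exists_generic_lines_through: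
  assumes A: "arrangement_of_lines A"
  obtains G where "generic_lines_through A p G"
proof -
  define F where "F = {L \<in> pencil p. L \<in> lines A \<or> (\<exists>q\<in>multiple_points A. q \<noteq> p \<and> q \<in> L)}"
  have "finite {L \<in> pencil p. q \<in> L}" if "q \<noteq> p" for q
  proof (cases "{L \<in> pencil p. q \<in> L} = {}")
    case False
    then obtain L where "L \<in> pencil p" "q \<in> L"
      by blast
    then have "{L \<in> pencil p. q \<in> L} \<subseteq> {L}"
      using at_most_one_point that unfolding pencil_def by blast
    then show ?thesis
      using finite_subset by blast
  qed (simp only: finite.emptyI)
  then have "finite (lines A \<union> (\<Union>q\<in>multiple_points A - {p}. {L \<in> pencil p. q \<in> L}))"
    using finite_multiple_points[OF A] by (auto simp: lines_def)
  then have "finite F"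
    by (rule finite_subset[rotated]) (auto simp: F_def)
  moreover have "F \<subseteq> pencil p"
    by (auto simp: F_def)
  moreover have "L \<notin> lines A \<and> (\<forall>q\<in>multiple_points A. q \<noteq> p \<longrightarrow> q \<notin> L)" if "L \<in> pencil p - F" for L
    using that by (auto simp: F_def)
  ultimately have "generic_lines_through A p (pencil p - F)"
    unfolding generic_lines_through_def by blast
  then show ?thesis
    by (rule that)
qed

section \<open>The minimal degree after adding a line\<close>

lemma linear_form_in_linear_forms_iff: "linear_form a \<in> linear_forms \<longleftrightarrow> a \<noteq> 0"
proof
  assume "linear_form a \<in> linear_forms"
  then obtain b where "linear_form a = linear_form b" "b \<noteq> 0"
    unfolding linear_forms_def by blast
  then show "a \<noteq> 0"
    by (metis linear_form_eq_0_iff)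
qed (auto simp: linear_forms_def)

lemma reduced_iff_arrangement_of_lines:
  "arrangement_of_lines (map linear_form as) \<longleftrightarrow> reduced as"
proof -
  have "set (map linear_form as) \<subseteq> linear_forms \<longleftrightarrow> 0 \<notin> set as"
    using linear_form_in_linear_forms_iff by auto
  moreover have "distinct (map line (map linear_form as)) \<longleftrightarrow>
      distinct as \<and> (\<forall>a\<in>set as. \<forall>b\<in>set as. a \<noteq> b \<longrightarrow> crossC a b \<noteq> 0)" if "0 \<notin> set as"
  proof -
    have "line (linear_form a) = line (linear_form b) \<longleftrightarrow> crossC a b = 0"
      if "a \<in> set as" "b \<in> set as" for a b
      using that \<open>0 \<notin> set as\<close> by (intro line_eq_iff) auto
    then show ?thesis
      unfolding map_map distinct_map inj_on_def by auto
  qed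
  ultimately show ?thesis
    unfolding arrangement_of_lines_def reduced_def by blast
qed

definition minimal_field_degree :: "arrangement \<Rightarrow> nat \<Rightarrow> bool" where
  "minimal_field_degree A r \<longleftrightarrow>
     (\<exists>as. A = map linear_form as \<and> as \<noteq> [] \<and> has_field (set as) r \<and> no_field_below (set as) r)"

lemma mdr_eq_minimal_field_degree:
  assumes "arrangement_of_lines A" "minimal_field_degree A r"
  shows "mdr (equation A) = r"
  using assms mdr_eq reduced_iff_arrangement_of_lines unfolding minimal_field_degree_def by blast

text \<open>
  Leaving out the lines \<open>J\<close>, the arrangement cuts the new line in distinct points.
\<close>

lemma minimal_field_degree_append:
  assumes A: "arrangement_of_lines A" and min: "minimal_field_degree A r"
    and l: "l \<in> linear_forms" "line l \<notin> lines A"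
    and J: "J \<subseteq> {..<length A}" "r + 2 + card J \<le> length A"
    and points: "\<And>q. q \<in> multiple_points A \<Longrightarrow> q \<in> line l \<Longrightarrow> card (lines_through A q - J) \<le> 1"
  shows "minimal_field_degree (A @ [l]) (Suc r)"
proof -
  obtain as where as: "A = map linear_form as" "as \<noteq> []" "has_field (set as) r" "no_field_below (set as) r"
    using min unfolding minimal_field_degree_def by blast
  obtain a where a: "a \<noteq> 0" "l = linear_form a"
    using l(1) unfolding linear_forms_def by blast
  have red: "reduced as"
    using A reduced_iff_arrangement_of_lines as(1) by blast
  have cross: "crossC a c \<noteq> 0" if "c \<in> set as" for c
  proof -
    have "c \<noteq> 0" "line (linear_form c) \<in> lines A"
      using that red by (auto simp: reduced_def lines_def as(1))
    then show ?thesis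
      using l(2) line_eq_iff[OF a(1), of c] a(2) by metis
  qed
  let ?n = "length A"
  have nth: "A ! i = linear_form (as ! i)" "as ! i \<in> set as" if "i < ?n" for i
    using that by (simp_all add: as(1))
  let ?B = "(!) as ` ({..<?n} - J)"
  have "inj_on ((!) as) ({..<?n} - J)"
    using red by (intro inj_on_nth) (auto simp: reduced_def as(1))
  then have "card ?B = ?n - card J"
    using J(1) finite_subset[OF J(1)] by (simp add: card_image card_Diff_subset)
  moreover have "triple_product a b b' \<noteq> 0" if b: "b \<in> ?B" "b' \<in> ?B" "b \<noteq> b'" for b b'
  proof
    assume triple: "triple_product a b b' = 0"
    obtain j k where jk: "j < ?n" "j \<notin> J" "b = as ! j" "k < ?n" "k \<notin> J" "b' = as ! k"
      using b by blast
    then have "j \<noteq> k"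
      using b(3) by blast
    have v: "crossC b b' \<noteq> 0"
      using red b(3) jk nth(2) unfolding reduced_def by blast
    \<comment> \<open>If two of the remaining lines met on the new line, their intersection would be
      a multiple point with two lines outside \<open>J\<close>.\<close>
    let ?q = "vec.span {crossC b b'}"
    have q: "j \<in> lines_through A ?q" "k \<in> lines_through A ?q" "?q \<in> line l"
      using v triple jk nth(1) by (simp_all add: lines_through_def span_in_line_iff a(2) triple_product_def)
    have "card {j, k} \<le> card (lines_through A ?q - J)"
      using q jk by (intro card_mono) auto
    then have "2 \<le> card (lines_through A ?q - J)"
      using \<open>j \<noteq> k\<close> by simp
    moreover have "?q \<in> multiple_points A"
      using two_lines_through_imp_multiple[OF A q(1,2) \<open>j \<noteq> k\<close>] .
    ultimately show False
      using points[of ?q] q(3) by simp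
  qed
  moreover have "?B \<subseteq> set as"
    using nth(2) by blast
  ultimately have "no_field_below (insert a (set as)) (Suc r)"
    using J(2) by (intro no_field_below_insert[OF as(4) cross, of ?B]) auto
  moreover have "has_field (insert a (set as)) (Suc r)"
    using has_field_insert[OF as(3) a(1)] .
  ultimately show ?thesis
    unfolding minimal_field_degree_def by (intro exI[of _ "as @ [a]"]) (simp add: as(1) a(2))
qed

section \<open>Pairs of arrangements with isomorphic lattices\<close>

text \<open>The invariant passed from step to step. Equality of flats replaces the isomorphism, and
  counts for \<open>A\<close> suffice because they depend on the flats alone.\<close>

definition lattice_pair ::
  "arrangement \<Rightarrow> arrangement \<Rightarrow> nat \<Rightarrow> nat \<Rightarrow> nat \<Rightarrow> nat \<Rightarrow> bool" where
  "lattice_pair A B n r d t \<longleftrightarrow>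
     arrangement_of_lines A \<and> arrangement_of_lines B \<and> length A = n \<and> length B = n \<and>
     flats A = flats B \<and> minimal_field_degree A r \<and> minimal_field_degree B (Suc r) \<and>
     card {K \<in> flats A. card K = 2} = d \<and> card {K \<in> flats A. card K = 3} = t"

lemma lattice_pair_conclusions:
  assumes "lattice_pair A B n r d t"
  shows "lattices_isomorphic A B" "mdr (equation A) = r" "mdr (equation B) = Suc r"
    "card (triple_points A) = t" "card (double_points A) = d"
    "card (triple_points B) = t" "card (double_points B) = d"
proof -
  note assms[unfolded lattice_pair_def]
  then have *: "arrangement_of_lines A" "arrangement_of_lines B" "length A = length B" "flats A = flats B"
    "minimal_field_degree A r" "minimal_field_degree B (Suc r)"
    "card {K \<in> flats A. card K = 2} = d" "card {K \<in> flats A. card K = 3} = t"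
    by auto
  show "lattices_isomorphic A B"
    using * by (intro lattices_isomorphic_if_flats_eq)
  show "mdr (equation A) = r" "mdr (equation B) = Suc r"
    using * by (simp_all add: mdr_eq_minimal_field_degree)
  show "card (triple_points A) = t" "card (double_points A) = d"
    "card (triple_points B) = t" "card (double_points B) = d"
    unfolding triple_points_def double_points_def using * by (simp_all add: card_points_of_multiplicity)
qed

text \<open>The larger degree \<open>r + 1\<close>, that of \<open>B\<close>, needs
  \<open>(r + 1) + 2\<close> intersection points, and a generic line meets all \<open>n\<close>
  lines in different points.\<close>

lemma lattice_pair_generic_line:
  assumes pair: "lattice_pair A B n r d t" and n: "r + 3 \<le> n"
    and l: "l \<in> linear_forms" "line l \<notin> lines A" "\<And>q. q \<in> multiple_points A \<Longrightarrow> q \<notin> line l"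
    and l': "l' \<in> linear_forms" "line l' \<notin> lines B" "\<And>q. q \<in> multiple_points B \<Longrightarrow> q \<notin> line l'"
  shows "lattice_pair (A @ [l]) (B @ [l']) (Suc n) (Suc r) (d + n) t"
proof -
  have A: "arrangement_of_lines A" "length A = n" "minimal_field_degree A r"
    and B: "arrangement_of_lines B" "length B = n" "minimal_field_degree B (Suc r)"
    and AB: "flats A = flats B"
    and dt: "card {K \<in> flats A. card K = 2} = d" "card {K \<in> flats A. card K = 3} = t"
    using pair unfolding lattice_pair_def by auto
  have "{q \<in> multiple_points A. q \<in> line l} = {}" "{q \<in> multiple_points B. q \<in> line l'} = {}"
    using l(3) l'(3) by auto
  then have flats: "flats (A @ [l]) = next_flats n (flats A) {}" "flats (B @ [l']) = next_flats n (flats A) {}"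
    using flats_append[OF A(1) l(1,2)] flats_append[OF B(1) l'(1,2)] by (simp_all only: A B AB image_empty)
  have "minimal_field_degree (A @ [l]) (Suc r)"
    by (rule minimal_field_degree_append[OF A(1,3) l(1,2), of "{}"]) (use l(3) n in \<open>auto simp: A\<close>)
  moreover have "minimal_field_degree (B @ [l']) (Suc (Suc r))"
    by (rule minimal_field_degree_append[OF B(1,3) l'(1,2), of "{}"]) (use l'(3) n in \<open>auto simp: B\<close>)
  moreover have "arrangement_of_lines (A @ [l])" "arrangement_of_lines (B @ [l'])"
    using arrangement_of_lines_append A B l l' by blast+
  moreover have "K \<subseteq> {..<n}" if "K \<in> flats A" for K
    using flats_subset[OF that] A(2) by simp
  note card_flats_generic[OF this finite_flats]
  ultimately show ?thesis
    unfolding lattice_pair_def flats by (simp add: A B dt)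
qed

text \<open>The two lines through the double point cut the new line at the same place, so one of
  them is set aside and the requirement grows to \<open>r + 4\<close>. Both applications below have
  \<open>n = r + 4\<close>.\<close>

lemma lattice_pair_line_through_double_point:
  assumes pair: "lattice_pair A B n r d t" and n: "r + 4 \<le> n"
    and p: "p \<in> double_points A" "corresponding_points A B p p'"
    and l: "l \<in> linear_forms" "line l \<notin> lines A" "p \<in> line l"
      "\<And>q. q \<in> multiple_points A \<Longrightarrow> q \<noteq> p \<Longrightarrow> q \<notin> line l"
    and l': "l' \<in> linear_forms" "line l' \<notin> lines B" "p' \<in> line l'"
      "\<And>q. q \<in> multiple_points B \<Longrightarrow> q \<noteq> p' \<Longrightarrow> q \<notin> line l'"
  shows "lattice_pair (A @ [l]) (B @ [l']) (Suc n) (Suc r) (d + n - 3) (t + 1)"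
proof -
  have A: "arrangement_of_lines A" "length A = n" "minimal_field_degree A r"
    and B: "arrangement_of_lines B" "length B = n" "minimal_field_degree B (Suc r)"
    and AB: "flats A = flats B"
    and dt: "card {K \<in> flats A. card K = 2} = d" "card {K \<in> flats A. card K = 3} = t"
    using pair unfolding lattice_pair_def by auto
  define I where "I = lines_through A p"
  have I': "lines_through B p' = I"
    unfolding I_def using lines_through_corresponding_points[OF p(2)] by simp
  have I: "card I = 2"
    using p(1) multiplicity_at_eq[OF A(1)] unfolding double_points_def I_def by simp
  then have mult: "p \<in> multiple_points A" "p' \<in> multiple_points B"
    using multiple_points_iff[OF A(1)] multiple_points_iff[OF B(1)] I' by (simp_all add: I_def)
  then have "{q \<in> multiple_points A. q \<in> line l} = {p}" "{q \<in> multiple_points B. q \<in> line l'} = {p'}"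
    using l l' by auto
  then have flats: "flats (A @ [l]) = next_flats n (flats A) {I}" "flats (B @ [l']) = next_flats n (flats A) {I}"
    using flats_append[OF A(1) l(1,2)] flats_append[OF B(1) l'(1,2)]
    by (simp_all only: A B AB image_insert image_empty I' I_def[symmetric])
  obtain i where i: "i \<in> I"
    using I by fastforce
  then have "i < n"
    using lines_through_subset[of A p] A(2) unfolding I_def by blast
  have card: "card (I - {i}) \<le> 1"
    using i I by simp
  have "minimal_field_degree (A @ [l]) (Suc r)"
  proof (rule minimal_field_degree_append[OF A(1,3) l(1,2), of "{i}"])
    show "card (lines_through A q - {i}) \<le> 1" if "q \<in> multiple_points A" "q \<in> line l" for q
      using that l(4) card unfolding I_def by metis
  qed (use n \<open>i < n\<close> in \<open>auto simp: A\<close>)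
  moreover have "minimal_field_degree (B @ [l']) (Suc (Suc r))"
  proof (rule minimal_field_degree_append[OF B(1,3) l'(1,2), of "{i}"])
    show "card (lines_through B q - {i}) \<le> 1" if "q \<in> multiple_points B" "q \<in> line l'" for q
      using that l'(4) card I' by metis
  qed (use n \<open>i < n\<close> in \<open>auto simp: B\<close>)
  moreover have "arrangement_of_lines (A @ [l])" "arrangement_of_lines (B @ [l'])"
    using arrangement_of_lines_append A B l l' by blast+
  moreover have "K \<subseteq> {..<n}" if "K \<in> flats A" for K
    using flats_subset[OF that] A(2) by simp
  note card_flats_through_double_point[OF this finite_flats _ I]
  moreover have "I \<in> flats A"
    using mult(1) unfolding I_def flats_def by blast
  ultimately show ?thesis
    unfolding lattice_pair_def flats by (simp add: A B dt)
qed

lemma exists_generic_lines_of_lattice_pair: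
  assumes pair: "lattice_pair A A' n r d t" and n: "r + 3 \<le> n"
    and Q: "\<And>l l'. lattice_pair (A @ [l]) (A' @ [l']) (Suc n) (Suc r) (d + n) t \<Longrightarrow> Q (A @ [l]) (A' @ [l'])"
  shows "\<exists>G G'. generic_lines A G \<and> generic_lines A' G' \<and>
    (\<forall>l\<in>linear_forms. \<forall>l'\<in>linear_forms. line l \<in> G \<longrightarrow> line l' \<in> G' \<longrightarrow> Q (A @ [l]) (A' @ [l']))"
proof -
  have "arrangement_of_lines A" "arrangement_of_lines A'" "2 \<le> length A" "2 \<le> length A'"
    using pair n unfolding lattice_pair_def by auto
  then obtain G G' where G: "generic_lines A G" "generic_lines A' G'"
    using exists_generic_lines by metis
  have "L \<notin> lines A \<and> (\<forall>q\<in>multiple_points A. q \<notin> L)" if "L \<in> G" for L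
    using G that unfolding generic_lines_def by blast
  moreover have "L \<notin> lines A' \<and> (\<forall>q\<in>multiple_points A'. q \<notin> L)" if "L \<in> G'" for L
    using G that unfolding generic_lines_def by blast
  ultimately have "Q (A @ [l]) (A' @ [l'])"
    if "l \<in> linear_forms" "l' \<in> linear_forms" "line l \<in> G" "line l' \<in> G'" for l l'
    using that by (intro Q lattice_pair_generic_line[OF pair n]) simp_all
  then show ?thesis
    using G by blast
qed

lemma exists_generic_lines_through_double_point_of_lattice_pair:
  assumes pair: "lattice_pair A A' n r d t" and n: "r + 4 \<le> n"
    and p: "p \<in> double_points A" "corresponding_points A A' p p'"
    and Q: "\<And>l l'. lattice_pair (A @ [l]) (A' @ [l']) (Suc n) (Suc r) (d + n - 3) (t + 1) \<Longrightarrow>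
      Q (A @ [l]) (A' @ [l'])"
  shows "\<exists>G G'. generic_lines_through A p G \<and> generic_lines_through A' p' G' \<and>
    (\<forall>l\<in>linear_forms. \<forall>l'\<in>linear_forms. line l \<in> G \<longrightarrow> line l' \<in> G' \<longrightarrow> Q (A @ [l]) (A' @ [l']))"
proof -
  have "arrangement_of_lines A" "arrangement_of_lines A'"
    using pair unfolding lattice_pair_def by auto
  then obtain G G' where G: "generic_lines_through A p G" "generic_lines_through A' p' G'"
    using exists_generic_lines_through by metis
  have "p \<in> L \<and> L \<notin> lines A \<and> (\<forall>q\<in>multiple_points A. q \<noteq> p \<longrightarrow> q \<notin> L)" if "L \<in> G" for L
    using G that unfolding generic_lines_through_def pencil_def by blast
  moreover have "p' \<in> L \<and> L \<notin> lines A' \<and> (\<forall>q\<in>multiple_points A'. q \<noteq> p' \<longrightarrow> q \<notin> L)" if "L \<in> G'" for L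
    using G that unfolding generic_lines_through_def pencil_def by blast
  ultimately have "Q (A @ [l]) (A' @ [l'])"
    if "l \<in> linear_forms" "l' \<in> linear_forms" "line l \<in> G" "line l' \<in> G'" for l l'
    using that by (intro Q lattice_pair_line_through_double_point[OF pair n p]) simp_all
  then show ?thesis
    using G by blast
qed

section \<open>The flats of the arrangements of nine lines\<close>

definition concurrent_lines :: "(int \<times> int \<times> int) list \<Rightarrow> nat \<times> nat \<Rightarrow> nat list" where
  "concurrent_lines xs ij =
     filter (\<lambda>k. int_pair (xs ! k) (int_cross (xs ! fst ij) (xs ! snd ij)) = 0) [0..<length xs]"

text \<open>A point appears once for every pair of lines meeting there, a triple point thus three
  times; duplicates are removed only for counting.\<close>

definition flat_list :: "(int \<times> int \<times> int) list \<Rightarrow> nat list list" where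
  "flat_list xs = map (concurrent_lines xs)
     (concat (map (\<lambda>j. map (\<lambda>i. (i, j)) [0..<j]) [0..<length xs]))"

lemma int_pair_int_cross: "int_pair a (int_cross a b) = 0" "int_pair b (int_cross a b) = 0"
  by (cases a; cases b; simp add: int_pair.simps int_cross.simps algebra_simps)+

lemma flats_int_vec:
  assumes "int_reduced xs"
  shows "flats (map linear_form (map int_vec xs)) = set ` set (flat_list xs)"
proof -
  let ?A = "map linear_form (map int_vec xs)"
  have A: "arrangement_of_lines ?A"
    using reduced_iff_arrangement_of_lines reduced_int_vec[OF assms] by blast
  define p where "p i j = vec.span {crossC (int_vec (xs ! i)) (int_vec (xs ! j))}" for i j
  have p: "lines_through ?A (p i j) = set (concurrent_lines xs (i, j))" "p i j \<in> multiple_points ?A"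
    if "i < j" "j < length xs" for i j
  proof -
    have "xs ! i \<noteq> xs ! j"
      using assms that nth_eq_iff_index_eq[of xs i j] unfolding int_reduced_def by simp
    then have "crossC (int_vec (xs ! i)) (int_vec (xs ! j)) \<noteq> 0"
      using assms that unfolding int_reduced_def by simp
    then have in_line: "p i j \<in> line (linear_form (int_vec (xs ! k))) \<longleftrightarrow>
        int_pair (xs ! k) (int_cross (xs ! i) (xs ! j)) = 0" for k
      unfolding p_def by (subst span_in_line_iff) simp_all
    have "k \<in> lines_through ?A (p i j) \<longleftrightarrow> k \<in> set (concurrent_lines xs (i, j))" for k
      using in_line[of k] by (cases "k < length xs") (simp_all add: lines_through_def concurrent_lines_def)
    then show "lines_through ?A (p i j) = set (concurrent_lines xs (i, j))"
      by blast
    have "i \<in> lines_through ?A (p i j)" "j \<in> lines_through ?A (p i j)"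
      using in_line[of i] in_line[of j] that by (simp_all add: lines_through_def int_pair_int_cross)
    then show "p i j \<in> multiple_points ?A"
      using two_lines_through_imp_multiple[OF A] that by blast
  qed
  have "set (concat (map (\<lambda>j. map (\<lambda>i. (i, j)) [0..<j]) [0..<length xs])) =
      {(i, j). i < j \<and> j < length xs}"
    by auto
  then have pairs: "set (flat_list xs) = {concurrent_lines xs (i, j) | i j. i < j \<and> j < length xs}"
    unfolding flat_list_def set_map by auto
  show ?thesis
  proof (intro equalityI subsetI)
    fix K assume "K \<in> flats ?A"
    then obtain q where q: "q \<in> multiple_points ?A" "K = lines_through ?A q"
      unfolding flats_def by blast
    obtain i j where ij: "i \<in> K" "j \<in> K" "i < j"
      using multiple_point_two_lines[OF A q(1)] unfolding q(2) by (metis linorder_neqE_nat)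
    then have "j < length xs"
      using lines_through_subset q(2) by fastforce
    have "i \<in> lines_through ?A (p i j)" "j \<in> lines_through ?A (p i j)"
      unfolding p(1)[OF ij(3) \<open>j < length xs\<close>]
      using ij \<open>j < length xs\<close> by (auto simp: concurrent_lines_def int_pair_int_cross)
    then have "q = p i j"
      using point_eq_if_two_lines_through[OF A, of i j q "p i j"] ij q(2) by blast
    then have "K = set (concurrent_lines xs (i, j))"
      using p(1)[OF ij(3) \<open>j < length xs\<close>] q(2) by simp
    then show "K \<in> set ` set (flat_list xs)"
      unfolding pairs using ij(3) \<open>j < length xs\<close> by blast
  next
    fix K assume "K \<in> set ` set (flat_list xs)"
    then obtain i j where "i < j" "j < length xs" "K = set (concurrent_lines xs (i, j))"
      unfolding pairs by blast
    then show "K \<in> flats ?A"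
      using p[of i j] unfolding flats_def by blast
  qed
qed

text \<open>The index lists are increasing, so equal sets come from equal lists and removing
  duplicate lists counts flats.\<close>

lemma card_flats_int_vec:
  assumes "int_reduced xs"
  shows "card {K \<in> flats (map linear_form (map int_vec xs)). card K = m} =
    length (remdups (filter (\<lambda>K. length K = m) (flat_list xs)))"
proof -
  have sorted: "sorted K" "distinct K" if "K \<in> set (flat_list xs)" for K
    using that by (auto simp: flat_list_def concurrent_lines_def intro!: sorted_wrt_filter)
  then have len: "card (set K) = length K" if "K \<in> set (flat_list xs)" for K
    using that distinct_card by blast
  have "{K \<in> flats (map linear_form (map int_vec xs)). card K = m} =
      set ` set (filter (\<lambda>K. length K = m) (flat_list xs))"
    unfolding flats_int_vec[OF assms] using len by auto
  moreover have "inj_on set (set (filter (\<lambda>K. length K = m) (flat_list xs)))"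
  proof (rule inj_onI)
    fix K L assume "K \<in> set (filter (\<lambda>K. length K = m) (flat_list xs))"
      "L \<in> set (filter (\<lambda>K. length K = m) (flat_list xs))" "set K = set L"
    then show "K = L"
      using sorted[of K] sorted[of L] sorted_distinct_set_unique[of K L] by auto
  qed
  ultimately show ?thesis
    by (simp only: card_image length_remdups_card_conv)
qed

text \<open>This computation is the source of all the lattice isomorphisms: each pair of lines has
  the same concurrent lines in both arrangements.\<close>

lemma flat_list_vecsA': "flat_list vecsA' = flat_list vecsA"
  by code_simp

text \<open>The counts match the number of pairs of lines, \<open>36 = 18 + 3 * 6\<close>.\<close>

lemma length_flat_list_vecsA:
  "length (remdups (filter (\<lambda>K. length K = 2) (flat_list vecsA))) = 18"
  "length (remdups (filter (\<lambda>K. length K = 3) (flat_list vecsA))) = 6"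
  by code_simp+

lemma lattice_pair_arrA: "lattice_pair arrA arrA' 9 5 18 6"
  unfolding lattice_pair_def arrA_eq arrA'_eq
proof (intro conjI)
  show "arrangement_of_lines (map linear_form (map int_vec vecsA))"
    "arrangement_of_lines (map linear_form (map int_vec vecsA'))"
    by (simp_all only: reduced_iff_arrangement_of_lines reduced_int_vec int_reduced_vecsA int_reduced_vecsA')
  show "length (map linear_form (map int_vec vecsA)) = 9"
    "length (map linear_form (map int_vec vecsA')) = 9"
    by (simp_all add: vecsA_def vecsA'_def)
  show "flats (map linear_form (map int_vec vecsA)) = flats (map linear_form (map int_vec vecsA'))"
    by (simp only: flats_int_vec int_reduced_vecsA int_reduced_vecsA' flat_list_vecsA')
  show "minimal_field_degree (map linear_form (map int_vec vecsA)) 5"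
    using has_field_vecsA no_field_below_vecsA unfolding minimal_field_degree_def
    by (intro exI[of _ "map int_vec vecsA"]) (simp add: vecsA_def)
  show "minimal_field_degree (map linear_form (map int_vec vecsA')) (Suc 5)"
    using has_field_vecsA' no_field_below_vecsA' unfolding minimal_field_degree_def
    by (intro exI[of _ "map int_vec vecsA'"]) (simp add: vecsA'_def)
  show "card {K \<in> flats (map linear_form (map int_vec vecsA)). card K = 2} = 18"
    by (simp only: card_flats_int_vec[OF int_reduced_vecsA] length_flat_list_vecsA)
  show "card {K \<in> flats (map linear_form (map int_vec vecsA)). card K = 3} = 6"
    by (simp only: card_flats_int_vec[OF int_reduced_vecsA] length_flat_list_vecsA)
qed

theorem mainTheorem1:
  shows
   "lattices_isomorphic arrA arrA' \<and>
    mdr (equation arrA) = 5 \<and> mdr (equation arrA') = 6 \<and>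
    (\<exists>G1 G1'. generic_lines arrA G1 \<and> generic_lines arrA' G1' \<and>
      (\<forall>l1\<in>linear_forms. \<forall>l1'\<in>linear_forms. line l1 \<in> G1 \<longrightarrow> line l1' \<in> G1' \<longrightarrow>
        (let A1 = arrA @ [l1]; A1' = arrA' @ [l1'] in
          lattices_isomorphic A1 A1' \<and>
          mdr (equation A1) = 6 \<and> mdr (equation A1') = 7 \<and>
          (\<forall>p\<in>double_points A1. \<forall>p'\<in>double_points A1'. corresponding_points A1 A1' p p' \<longrightarrow>
            (\<exists>G2 G2'. generic_lines_through A1 p G2 \<and> generic_lines_through A1' p' G2' \<and>
              (\<forall>l2\<in>linear_forms. \<forall>l2'\<in>linear_forms. line l2 \<in> G2 \<longrightarrow> line l2' \<in> G2' \<longrightarrow>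
                (let A2 = A1 @ [l2]; A2' = A1' @ [l2'] in
                  lattices_isomorphic A2 A2' \<and>
                  mdr (equation A2) = 7 \<and> mdr (equation A2') = 8 \<and>
                  (\<forall>q\<in>double_points A2. \<forall>q'\<in>double_points A2'. corresponding_points A2 A2' q q' \<longrightarrow>
                    (\<exists>G3 G3'. generic_lines_through A2 q G3 \<and> generic_lines_through A2' q' G3' \<and>
                      (\<forall>l3\<in>linear_forms. \<forall>l3'\<in>linear_forms. line l3 \<in> G3 \<longrightarrow> line l3' \<in> G3' \<longrightarrow>
                        (let A3 = A2 @ [l3]; A3' = A2' @ [l3'] in
                          lattices_isomorphic A3 A3' \<and>
                          mdr (equation A3) = 8 \<and> mdr (equation A3') = 9 \<and>
                          card (triple_points A3) = 8 \<and> card (double_points A3) = 42 \<and>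
                          card (triple_points A3') = 8 \<and> card (double_points A3') = 42)))))))))))"
proof -
  \<comment> \<open>The nested claim is split into predicates of a pair of arrangements, innermost
    first, each of which follows from the invariant alone.\<close>
  define Q3 where "Q3 A3 A3' \<longleftrightarrow> lattices_isomorphic A3 A3' \<and>
      mdr (equation A3) = 8 \<and> mdr (equation A3') = 9 \<and>
      card (triple_points A3) = 8 \<and> card (double_points A3) = 42 \<and>
      card (triple_points A3') = 8 \<and> card (double_points A3') = 42" for A3 A3'
  define Q2 where "Q2 A2 A2' \<longleftrightarrow> lattices_isomorphic A2 A2' \<and>
      mdr (equation A2) = 7 \<and> mdr (equation A2') = 8 \<and>
      (\<forall>q\<in>double_points A2. \<forall>q'\<in>double_points A2'. corresponding_points A2 A2' q q' \<longrightarrow>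
        (\<exists>G3 G3'. generic_lines_through A2 q G3 \<and> generic_lines_through A2' q' G3' \<and>
          (\<forall>l3\<in>linear_forms. \<forall>l3'\<in>linear_forms. line l3 \<in> G3 \<longrightarrow> line l3' \<in> G3' \<longrightarrow>
            Q3 (A2 @ [l3]) (A2' @ [l3']))))" for A2 A2'
  define Q1 where "Q1 A1 A1' \<longleftrightarrow> lattices_isomorphic A1 A1' \<and>
      mdr (equation A1) = 6 \<and> mdr (equation A1') = 7 \<and>
      (\<forall>p\<in>double_points A1. \<forall>p'\<in>double_points A1'. corresponding_points A1 A1' p p' \<longrightarrow>
        (\<exists>G2 G2'. generic_lines_through A1 p G2 \<and> generic_lines_through A1' p' G2' \<and>
          (\<forall>l2\<in>linear_forms. \<forall>l2'\<in>linear_forms. line l2 \<in> G2 \<longrightarrow> line l2' \<in> G2' \<longrightarrow>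
            Q2 (A1 @ [l2]) (A1' @ [l2']))))" for A1 A1'
  \<comment> \<open>Double points: \<open>18 + 9 = 27\<close>, \<open>27 + 10 - 3 = 34\<close>,
    \<open>34 + 11 - 3 = 42\<close>. Triple points: \<open>6\<close>, then \<open>7\<close> and
    \<open>8\<close>.\<close>
  have Q3: "Q3 A A'" if "lattice_pair A A' 12 8 42 8" for A A'
    unfolding Q3_def using lattice_pair_conclusions[OF that] by simp
  have Q2: "Q2 A A'" if "lattice_pair A A' 11 7 34 7" for A A'
    unfolding Q2_def
  proof (intro conjI ballI impI)
    show "\<exists>G G'. generic_lines_through A q G \<and> generic_lines_through A' q' G' \<and>
        (\<forall>l\<in>linear_forms. \<forall>l'\<in>linear_forms. line l \<in> G \<longrightarrow> line l' \<in> G' \<longrightarrow> Q3 (A @ [l]) (A' @ [l']))"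
      if "q \<in> double_points A" "corresponding_points A A' q q'" for q q'
      by (rule exists_generic_lines_through_double_point_of_lattice_pair[OF \<open>lattice_pair A A' 11 7 34 7\<close> _ that])
        (simp_all add: Q3)
  qed (use lattice_pair_conclusions[OF that] in simp_all)
  have Q1: "Q1 A A'" if "lattice_pair A A' 10 6 27 6" for A A'
    unfolding Q1_def
  proof (intro conjI ballI impI)
    show "\<exists>G G'. generic_lines_through A q G \<and> generic_lines_through A' q' G' \<and>
        (\<forall>l\<in>linear_forms. \<forall>l'\<in>linear_forms. line l \<in> G \<longrightarrow> line l' \<in> G' \<longrightarrow> Q2 (A @ [l]) (A' @ [l']))"
      if "q \<in> double_points A" "corresponding_points A A' q q'" for q q'
      by (rule exists_generic_lines_through_double_point_of_lattice_pair[OF \<open>lattice_pair A A' 10 6 27 6\<close> _ that])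
        (simp_all add: Q2)
  qed (use lattice_pair_conclusions[OF that] in simp_all)
  have "\<exists>G G'. generic_lines arrA G \<and> generic_lines arrA' G' \<and>
      (\<forall>l\<in>linear_forms. \<forall>l'\<in>linear_forms. line l \<in> G \<longrightarrow> line l' \<in> G' \<longrightarrow>
        Q1 (arrA @ [l]) (arrA' @ [l']))"
    by (rule exists_generic_lines_of_lattice_pair[OF lattice_pair_arrA]) (simp_all add: Q1)
  moreover have "lattices_isomorphic arrA arrA'" "mdr (equation arrA) = 5" "mdr (equation arrA') = 6"
    using lattice_pair_conclusions[OF lattice_pair_arrA] by simp_all
  ultimately show ?thesis
    unfolding Q1_def Q2_def Q3_def Let_def by blast
qed

end
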